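(* Let $f$ and $g$ be two continuous functions on $S^3$. Assume that for some $\zeta\in S^3$ and for every $w\in S^2(\zeta)$ there exists a rotation $\varphi_w\in SO(3,S^2(w))$ such that $$f\circ\varphi_w(\theta)=g(\theta)\qquad\forall\theta\in S^2(w).$$ Assume, in addition, that one of the following conditions holds: (a) $\varphi_w(\zeta)=\zeta$ for all $w\in S^2(\zeta)$; (b) $\varphi_w(\zeta)=\pm\zeta$ for all $w\in S^2(\zeta)$, and for every $w\in S^2(\zeta)$ the functions $f$ and $g$ have, on $S^2(w)$, no $(\zeta,\pi)$-rotational symmetry and no $(u,\pi)$-rotational symmetry for any $u\in S^2(\zeta)\cap S^2(w)$. Then either $f=g$ on $S^3$ or $f(\theta)=g(\mathcal{O}\theta)$ for all $\theta\in S^3$, where $\mathcal{O}\in O(4)$ is the orthogonal transformation satisfying $\mathcal{O}|_{S^2(\zeta)}=-I$ and $\mathcal{O}(\zeta)=\zeta$.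
   Context: For $w\in S^3$, $S^2(w)=\{\theta\in S^3:\theta\cdot w=0\}$, and $SO(3,S^2(w))$ is the group of rotations of the $3$-dimensional subspace $w^\perp$ spanned by $S^2(w)$. For $w\in S^3$ and $u\in S^2(w)$, a continuous function $f$ on $S^3$ has a $(u,\pi)$-rotational symmetry on $S^2(w)$ if $f\circ\varphi=f$ on $S^2(w)$, where $\varphi\in SO(3,S^2(w))$ is the rotation by the angle $\pi$ about $u$ (so $\varphi(u)=u$). *)

theory Defs
  imports "HOL-Analysis.Analysis"
begin

abbreviation S3 :: "(real ^ 4) set" where
  "S3 \<equiv> sphere 0 1"

definition S2 :: "real ^ 4 \<Rightarrow> (real ^ 4) set" where
  "S2 w = {\<theta> \<in> S3. \<theta> \<bullet> w = 0}"

text \<open>For \<open>w \<in> S3\<close>, a rotation of the three-dimensional space \<open>w\<^sup>\<bottom>\<close> is identified with its unique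
  linear extension to \<open>\<real>\<^sup>4\<close> fixing \<open>w\<close>. The extension acts on \<open>w\<^sup>\<bottom>\<close> by the given rotation, and it has
  the same determinant.\<close>

definition SO3 :: "real ^ 4 \<Rightarrow> (real ^ 4 \<Rightarrow> real ^ 4) set" where
  "SO3 w = {\<phi>. orthogonal_transformation \<phi> \<and> det (matrix \<phi>) = 1 \<and> \<phi> w = w}"

text \<open>\<open>\<phi>\<close> fixes \<open>u\<close> and turns every vector of the plane \<open>w\<^sup>\<bottom> \<inter> u\<^sup>\<bottom>\<close> by the angle \<open>\<alpha>\<close>. The plane is not
  oriented, so \<open>\<alpha>\<close> and \<open>-\<alpha>\<close> are not distinguished; for \<open>\<alpha> = \<pi>\<close> the rotation is nevertheless unique,
  see \<open>rotation_about_pi_iff\<close> below.\<close>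

definition rotation_about :: "real ^ 4 \<Rightarrow> real ^ 4 \<Rightarrow> real \<Rightarrow> (real ^ 4 \<Rightarrow> real ^ 4) \<Rightarrow> bool" where
  "rotation_about w u \<alpha> \<phi> \<longleftrightarrow>
     \<phi> \<in> SO3 w \<and> \<phi> u = u \<and>
     (\<forall>x. x \<bullet> w = 0 \<longrightarrow> x \<bullet> u = 0 \<longrightarrow> x \<bullet> \<phi> x = cos \<alpha> * (norm x)\<^sup>2)"

definition pi_rotational_symmetry :: "(real ^ 4 \<Rightarrow> real) \<Rightarrow> real ^ 4 \<Rightarrow> real ^ 4 \<Rightarrow> bool" where
  "pi_rotational_symmetry f w u \<longleftrightarrow>
     (\<exists>\<phi>. rotation_about w u pi \<phi> \<and> (\<forall>\<theta>\<in>S2 w. f (\<phi> \<theta>) = f \<theta>))"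

lemma reflection_orthogonal:
  fixes v :: "real ^ 'n"
  assumes "norm v = 1"
  shows "orthogonal_transformation (\<lambda>x. x - (2 * (x \<bullet> v)) *\<^sub>R v)"
proof -
  have v: "v \<bullet> v = 1" using assms by (simp add: norm_eq_1)
  have "linear (\<lambda>x. x - (2 * (x \<bullet> v)) *\<^sub>R v)"
    by (rule linearI)
      (simp_all only: inner_left_distrib inner_scaleR_left scaleR_left_distrib distrib_left
        scaleR_right_diff_distrib scaleR_scaleR mult.left_commute add_diff_add)
  moreover have "(x - (2 * (x \<bullet> v)) *\<^sub>R v) \<bullet> (y - (2 * (y \<bullet> v)) *\<^sub>R v) = x \<bullet> y" for x y
  proof -
    have "(x - (2 * (x \<bullet> v)) *\<^sub>R v) \<bullet> (y - (2 * (y \<bullet> v)) *\<^sub>R v)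
        = x \<bullet> y - 2 * (x \<bullet> v) * (v \<bullet> y) - 2 * (y \<bullet> v) * (x \<bullet> v - 2 * (x \<bullet> v) * (v \<bullet> v))"
      by (simp only: inner_diff_left inner_diff_right inner_scaleR_left inner_scaleR_right)
    also have "\<dots> = x \<bullet> y" unfolding v inner_commute[of v y] by (simp add: right_diff_distrib)
    finally show ?thesis .
  qed
  ultimately show ?thesis
    unfolding orthogonal_transformation_def by blast
qed

lemma reflection_det:
  fixes v :: "real ^ 'n"
  assumes "norm v = 1"
  shows "det (matrix (\<lambda>x. x - (2 * (x \<bullet> v)) *\<^sub>R v)) = -1"
proof -
  fix k :: 'n
  let ?r = "\<lambda>v x. x - (2 * (x \<bullet> v)) *\<^sub>R (v :: real ^ 'n)"
  let ?e = "axis k 1 :: real ^ 'n"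
  obtain A where A: "orthogonal_transformation A" "A v = ?e"
    using orthogonal_transformation_exists[of v ?e] assms by auto
  have lr: "linear (?r v)" "linear (?r ?e)"
    using reflection_orthogonal[of v] reflection_orthogonal[of ?e] assms
    by (auto simp: orthogonal_transformation_def)
  have lA: "linear A" using A(1) by (simp add: orthogonal_transformation_def)
  have "A \<circ> ?r v = ?r ?e \<circ> A"
  proof
    fix x
    have "A x \<bullet> A v = x \<bullet> v" using A(1) by (simp add: orthogonal_transformation_def)
    then show "(A \<circ> ?r v) x = (?r ?e \<circ> A) x"
      using lA by (simp add: linear_diff linear_scale A(2))
  qed
  then have "matrix A ** matrix (?r v) = matrix (?r ?e) ** matrix A"
    using lA lr by (simp flip: matrix_compose)
  then have "det (matrix A) * det (matrix (?r v)) = det (matrix (?r ?e)) * det (matrix A)"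
    by (simp flip: det_mul)
  moreover have "det (matrix A) \<noteq> 0"
    using A(1) det_orthogonal_matrix orthogonal_transformation_matrix by fastforce
  moreover have entry: "matrix (?r ?e) $ i $ j = (if i = j then if i = k then -1 else 1 else 0)"
    for i j
    by (simp add: matrix_def inner_axis_axis) (simp add: axis_def)
  ultimately have "det (matrix (?r v)) = det (matrix (?r ?e))" by simp
  also have "\<dots> = (\<Prod>i\<in>UNIV. matrix (?r ?e) $ i $ i)"
    by (rule det_diagonal) (simp add: entry)
  also have "\<dots> = (\<Prod>i\<in>UNIV. if i = k then -1 else 1)"
    by (simp add: entry)
  also have "\<dots> = -1" by simp
  finally show ?thesis .
qed

lemma rotation_about_pi_iff:
  assumes w: "w \<in> S3" and u: "u \<in> S2 w"
  shows "rotation_about w u pi \<phi> \<longleftrightarrow>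
           \<phi> = (\<lambda>x. (2 * (x \<bullet> u)) *\<^sub>R u + (2 * (x \<bullet> w)) *\<^sub>R w - x)"
    (is "_ \<longleftrightarrow> \<phi> = ?h")
proof
  have uw: "u \<bullet> u = 1" "w \<bullet> w = 1" "u \<bullet> w = 0" "w \<bullet> u = 0" "norm u = 1" "norm w = 1"
    using w u by (auto simp: S2_def norm_eq_1 inner_commute)
  {
    assume r: "rotation_about w u pi \<phi>"
    then have o: "orthogonal_transformation \<phi>" and fix_uw: "\<phi> u = u" "\<phi> w = w"
      by (auto simp: rotation_about_def SO3_def)
    then have l: "linear \<phi>" by (simp add: orthogonal_transformation_def)
    show "\<phi> = ?h"
    proof
      fix x
      define y where "y = x - (x \<bullet> u) *\<^sub>R u - (x \<bullet> w) *\<^sub>R w"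
      have "y \<bullet> w = 0" "y \<bullet> u = 0" by (simp_all add: y_def inner_diff_left uw)
      then have "y \<bullet> \<phi> y = - (norm y)\<^sup>2" using r by (simp add: rotation_about_def)
      moreover have "\<phi> y \<bullet> \<phi> y = (norm y)\<^sup>2"
        using o by (simp add: orthogonal_transformation_norm dot_square_norm)
      moreover have "(\<phi> y + y) \<bullet> (\<phi> y + y) = \<phi> y \<bullet> \<phi> y + 2 * (y \<bullet> \<phi> y) + (norm y)\<^sup>2"
        unfolding power2_norm_eq_inner
        by (simp only: inner_add_left inner_add_right inner_commute[of "\<phi> y" y])
      ultimately have "(\<phi> y + y) \<bullet> (\<phi> y + y) = 0" by linarith
      then have "\<phi> y = - y" by (simp only: inner_eq_zero_iff eq_neg_iff_add_eq_0)
      moreover have "\<phi> y = \<phi> x - (x \<bullet> u) *\<^sub>R u - (x \<bullet> w) *\<^sub>R w"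
        using l fix_uw by (simp add: y_def linear_diff linear_scale)
      ultimately have "\<phi> x = (x \<bullet> u) *\<^sub>R u + (x \<bullet> w) *\<^sub>R w - y" by (simp add: algebra_simps)
      then show "\<phi> x = ?h x" by (simp only: y_def mult_2 scaleR_left_distrib) simp
    qed
  next
    assume eq: "\<phi> = ?h"
    let ?r = "\<lambda>v x. x - (2 * (x \<bullet> v)) *\<^sub>R (v :: real ^ 4)"
    have h: "?h = uminus \<circ> (?r u \<circ> ?r w)"
      by (rule ext) (simp add: inner_diff_left uw algebra_simps)
    have orth: "orthogonal_transformation (?r u)" "orthogonal_transformation (?r w)"
      using uw by (simp_all add: reflection_orthogonal)
    then have orth2: "orthogonal_transformation (?r u \<circ> ?r w)"
      by (rule orthogonal_transformation_compose)
    have "det (matrix (uminus :: real ^ 4 \<Rightarrow> real ^ 4)) = (\<Prod>i\<in>(UNIV :: 4 set). -1)"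
      by (subst det_diagonal) (auto simp: matrix_def axis_def)
    then have "det (matrix (uminus :: real ^ 4 \<Rightarrow> real ^ 4)) = 1" by simp
    moreover have "matrix ?h = matrix uminus ** (matrix (?r u) ** matrix (?r w))"
      unfolding h using orth orth2
      by (simp only: matrix_compose orthogonal_transformation_linear linear_uminus)
    ultimately have "det (matrix ?h) = 1"
      using reflection_det[of u] reflection_det[of w] uw by (simp only: det_mul)
    moreover have "orthogonal_transformation ?h"
      unfolding h using orth2 by (simp only: orthogonal_transformation_neg comp_def)
    ultimately show "rotation_about w u pi \<phi>"
      unfolding rotation_about_def SO3_def eq
      by (auto simp: uw scaleR_2 dot_square_norm)
  }
qed

end

theory Submission
  imports Defs
begin

text \<open>Identify \<open>\<zeta>\<^sup>\<bottom>\<close> with \<open>\<real>\<^sup>3\<close> by an isometry \<open>L\<close>, extend \<open>f\<close> and \<open>g\<close> to positively homogeneous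
  functions and put \<open>F t v = f (t \<zeta> + L v)\<close>, \<open>G t v = g (t \<zeta> + L v)\<close>. On each great circle of \<open>S\<^sup>2\<close>, a map
  \<open>\<phi>\<^sub>w\<close> that fixes \<open>\<zeta>\<close> becomes a rotation taking every \<open>F t\<close> to \<open>G t\<close>, and one that reverses \<open>\<zeta>\<close> becomes
  a reflection taking every \<open>F (- t)\<close> to \<open>G t\<close>.

  Rotations: the Funk transform of \<open>F t\<close> and of \<open>(F t)\<^sup>2\<close> agrees with that of \<open>G t\<close> and \<open>(G t)\<^sup>2\<close>, so the
  even parts agree and the odd parts agree up to sign at each point. On a circle whose angle is not a
  rational multiple of \<open>\<pi>\<close> the odd part has constant absolute value, hence vanishes. If some circle
  were matched neither by the angle 0 nor by \<open>\<pi>\<close>, then by Baire a fixed angle \<open>\<alpha>\<close> with \<open>sin \<alpha> \<noteq> 0\<close> would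
  work for an open set of nearby circles; this makes \<open>F\<close> locally constant along one of them, so its odd
  part vanishes there, which is absurd. So every circle has angle 0 or \<open>\<pi>\<close>, and as any two points lie on
  a common circle, the same alternative holds on all of \<open>S\<^sup>2\<close>.

  Reflections: if \<open>c\<^sub>m\<close> and \<open>d\<^sub>m\<close> are the \<open>m\<close>-th Fourier coefficients of \<open>F\<close> and \<open>G\<close> along a circle, then
  \<open>c\<^sub>m d\<^sub>m = a\<^bsup>2m\<^esup> |c\<^sub>m|\<^sup>2\<close>, where \<open>a\<close> is the position of the axis. If no circle were centrally symmetric
  for \<open>F\<close>, a sum of suitable powers of these products would be a nowhere vanishing section of a
  nontrivial tensor power of the tangent bundle of \<open>S\<^sup>2\<close>, that is, a nowhere vanishing
  function on \<open>S\<^sup>3\<close> of nonzero weight along the Hopf fibres; its continuous logarithm contradicts this.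

  Under condition (b) the directions of the two kinds form disjoint closed sets covering the connected
  sphere, and reflections throughout would produce a forbidden \<open>(\<zeta>, \<pi>)\<close>-symmetry.\<close>

subsection \<open>The Funk transform\<close>

text \<open>With \<open>c = cis d\<close> this shifts the interval of integration by d; the piece
  that sticks out beyond 2 pi is moved back by periodicity.\<close>

lemma integral_circle_rotate:
  fixes A :: "complex \<Rightarrow> 'a::euclidean_space"
  assumes A: "continuous_on UNIV A" and c: "norm c = 1"
  shows "integral {0..2*pi} (\<lambda>x. A (c * cis x)) = integral {0..2*pi} (\<lambda>x. A (cis x))"
proof -
  obtain d where d: "0 \<le> d" "d < 2*pi" "c = cis d"
    using that[of "Arg2pi c"] c Arg2pi_ge_0[of c] Arg2pi_lt_2pi[of c] Arg2pi_eq[of c] by (simp add: cis_conv_exp)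
  have cont: "continuous_on S (\<lambda>x. A (cis x))" for S
    by (rule continuous_on_compose2[OF A]) (intro continuous_intros, auto)
  have int: "(\<lambda>x. A (cis x)) integrable_on {a..b}" for a b
    by (intro integrable_continuous_real cont)
  have "integral {0..2*pi} (\<lambda>x. A (c * cis x)) = integral {0..2*pi} (\<lambda>x. A (cis (x + d)))"
    by (simp add: d(3) cis_mult add.commute)
  also have "\<dots> = integral {d..2*pi+d} (\<lambda>x. A (cis x))"
    using integral_shift_real_ivl[of d d "2*pi+d" "\<lambda>x. A (cis x)"] by simp
  also have "\<dots> = integral {d..2*pi} (\<lambda>x. A (cis x)) + integral {2*pi..2*pi+d} (\<lambda>x. A (cis x))"
    using Henstock_Kurzweil_Integration.integral_combine[OF _ _ int, of d "2*pi" "2*pi+d"] d by simp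
  also have "integral {2*pi..2*pi+d} (\<lambda>x. A (cis x)) = integral {0..d} (\<lambda>x. A (cis (x + 2*pi)))"
    using integral_shift_real_ivl[of "2*pi" "2*pi" "2*pi+d" "\<lambda>x. A (cis x)"] by simp
  also have "\<dots> = integral {0..d} (\<lambda>x. A (cis x))"
    by (simp flip: cis_mult)
  also have "integral {d..2*pi} (\<lambda>x. A (cis x)) + \<dots> = integral {0..2*pi} (\<lambda>x. A (cis x))"
    using Henstock_Kurzweil_Integration.integral_combine[OF _ _ int, of 0 d "2*pi"] d by (simp add: add.commute)
  finally show ?thesis .
qed

lemma integral_circle_cnj:
  fixes A :: "complex \<Rightarrow> 'a::euclidean_space"
  shows "integral {0..2*pi} (\<lambda>x. A (cnj (cis x))) = integral {0..2*pi} (\<lambda>x. A (cis x))"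
proof -
  have "integral {0..2*pi} (\<lambda>x. A (cnj (cis x))) = integral {-(2*pi)..0} (\<lambda>x. A (cis x))"
    using Henstock_Kurzweil_Integration.integral_reflect_real[of 0 "-(2*pi)" "\<lambda>x. A (cis x)"] by (simp add: cis_cnj)
  also have "\<dots> = integral {0..2*pi} (\<lambda>x. A (cis x))"
    using integral_shift_real_ivl[of 0 "2*pi" "2*pi" "\<lambda>x. A (cis x)"] 
    by (simp add: cis_mult[symmetric])
  finally show ?thesis .
qed

text \<open>Integration by parts with the primitive \<open>- cos x * sin x ^ (n+1)\<close>.
  Requiring \<open>cos * sin\<close> to vanish at both ends kills the boundary terms on [0, 2 pi]
  and on [0, pi/2] alike.\<close>

lemma integral_sin_power_Suc_Suc:
  assumes ab: "a \<le> b" and "cos a * sin a = 0" "cos b * sin b = (0::real)"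
  shows "integral {a..b} (\<lambda>x. sin x ^ (n+2)) = (real n + 1) / (real n + 2) * integral {a..b} (\<lambda>x. sin x ^ n)"
proof -
  have "((\<lambda>x. (real n + 2) * sin x ^ (n+2) - (real n + 1) * sin x ^ n) has_integral
       (- cos b * sin b ^ (n+1)) - (- cos a * sin a ^ (n+1))) {a..b}"
  proof (rule fundamental_theorem_of_calculus[OF ab])
    fix x :: real
    have c: "(cos x)\<^sup>2 = 1 - (sin x)\<^sup>2" by (simp add: cos_squared_eq)
    have "((\<lambda>x. - cos x * sin x ^ (n+1)) has_real_derivative
        sin x * sin x ^ (n+1) - cos x * ((real n + 1) * sin x ^ n * cos x)) (at x within {a..b})"
      by (rule derivative_eq_intros refl | simp)+
    also have "sin x * sin x ^ (n+1) - cos x * ((real n + 1) * sin x ^ n * cos x)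
       = sin x ^ (n+2) - (real n + 1) * sin x ^ n * (cos x)\<^sup>2"
      by (simp add: power2_eq_square)
    also have "\<dots> = (real n + 2) * sin x ^ (n+2) - (real n + 1) * sin x ^ n"
      unfolding c by (simp add: algebra_simps power2_eq_square)
    finally show "((\<lambda>x. - cos x * sin x ^ (n+1)) has_vector_derivative
        (real n + 2) * sin x ^ (n+2) - (real n + 1) * sin x ^ n) (at x within {a..b})"
      by (simp add: has_real_derivative_iff_has_vector_derivative)
  qed
  also have "(- cos b * sin b ^ (n+1)) - (- cos a * sin a ^ (n+1)) = 0"
    using assms by auto
  finally have "integral {a..b} (\<lambda>x. (real n + 2) * sin x ^ (n+2) - (real n + 1) * sin x ^ n) = 0"
    by (rule integral_unique)
  moreover have "(\<lambda>x. sin x ^ k) integrable_on {a..b}" for k :: nat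
    by (intro integrable_continuous_real continuous_intros)
  ultimately have "(real n + 2) * integral {a..b} (\<lambda>x. sin x ^ (n+2)) = (real n + 1) * integral {a..b} (\<lambda>x. sin x ^ n)"
    by (subst (asm) integral_diff) (auto simp: integrable_on_cmult_left simp del: power_Suc power_add_numeral add_2_eq_Suc')
  then show ?thesis by (simp add: field_simps)
qed

text \<open>The case of the monomial \<open>z ^ n\<close> in \<open>hemisphere_integral\<close>. In
  steps of two, the reduction factors (n+1)/(n+2) and (n+2)/(n+3) of the two sine integrals
  telescope to (n+1)/(n+3), which is also the factor on the right for even n; for odd n both sides
  are 0.\<close>

lemma integral_sin_powers_product:
  "integral {0..2*pi} (\<lambda>x. sin x ^ n) * integral {0..pi/2} (\<lambda>x. sin x ^ (n+1))
     = pi * integral {-1..1} (\<lambda>z. z ^ n)"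
proof -
  have pw: "integral {-1..1} (\<lambda>z::real. z ^ n) = (1 - (-1) ^ (n+1)) / (real n + 1)" for n
  proof -
    have "((\<lambda>z::real. z ^ n) has_integral (1 ^ (n+1) / (real n + 1) - (-1) ^ (n+1) / (real n + 1))) {-1..1}"
    proof (rule fundamental_theorem_of_calculus)
      fix x :: real
      have "((\<lambda>z. z ^ (n+1) / (real n + 1)) has_real_derivative (real n + 1) * x ^ n / (real n + 1)) (at x within {-1..1})"
        by (rule derivative_eq_intros refl | simp add: add.commute)+
      then show "((\<lambda>z. z ^ (n+1) / (real n + 1)) has_vector_derivative x ^ n) (at x within {-1..1})"
        by (simp add: has_real_derivative_iff_has_vector_derivative)
    qed simp
    then show ?thesis by (simp only: integral_unique diff_divide_distrib power_one)
  qed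
  show ?thesis unfolding pw
  proof (induction n rule: nat_induct2)
    case 0
    have "integral {0..pi/2} sin = (1::real)"
      using integral_unique[OF fundamental_theorem_of_calculus[of 0 "pi/2" "\<lambda>x. - cos x" sin]]
      by (auto intro!: derivative_eq_intros simp flip: has_real_derivative_iff_has_vector_derivative)
    then show ?case by simp
  next
    case 1
    have "integral {0..2*pi} sin = (0::real)"
      using integral_unique[OF fundamental_theorem_of_calculus[of 0 "2*pi" "\<lambda>x. - cos x" sin]]
      by (auto intro!: derivative_eq_intros simp flip: has_real_derivative_iff_has_vector_derivative)
    then show ?case by simp
  next
    case (step n)
    have "integral {0..2*pi} (\<lambda>x. sin x ^ (n+2)) * integral {0..pi/2} (\<lambda>x. sin x ^ ((n+1)+2))
      = (real n + 1) / (real n + 2) * ((real n + 2) / (real n + 3)) * 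
        (integral {0..2*pi} (\<lambda>x. sin x ^ n) * integral {0..pi/2} (\<lambda>x. sin x ^ (n+1)))"
      using integral_sin_power_Suc_Suc[of 0 "2*pi" n] integral_sin_power_Suc_Suc[of 0 "pi/2" "n+1"]
      by (simp add: add_ac)
    also have "\<dots> = (real n + 1) / (real n + 3) * (pi * ((1 - (-1) ^ (n+1)) / (real n + 1)))"
      unfolding step by simp
    also have "\<dots> = pi * ((1 - (-1) ^ (n+2+1)) / (real (n+2) + 1))"
      by (simp add: divide_simps)
    finally show ?case by (simp add: add_ac)
  qed
qed

lemma continuous_on_circle_mean:
  fixes h :: "'b::topological_space \<Rightarrow> real \<Rightarrow> 'a::euclidean_space"
  assumes "continuous_on UNIV (\<lambda>(x, t). h x t)"
  shows "continuous_on S (\<lambda>x. integral {0..2*pi} (h x))"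
proof -
  have "continuous_on (S \<times> cbox 0 (2*pi)) (\<lambda>(x, t). h x t)"
    using assms by (rule continuous_on_subset) auto
  then show ?thesis
    using integral_continuous_on_param[of S 0 "2*pi" h] by simp
qed

text \<open>Abel inversion in disguise: both sides compute the integral of \<open>H\<close> of a coordinate over a half
  sphere up to the choice of the coordinate. By Weierstrass it suffices to treat monomials, where
  it is the Wallis formula.\<close>

lemma hemisphere_integral:
  fixes H :: "real \<Rightarrow> real"
  assumes H: "continuous_on UNIV H"
  shows "integral {0..pi/2} (\<lambda>\<theta>. sin \<theta> * integral {0..2*pi} (\<lambda>\<phi>. H (sin \<theta> * sin \<phi>)))
           = pi * integral {-1..1} H"
proof -
  define K where "K h \<theta> = integral {0..2*pi} (\<lambda>\<phi>. h (sin \<theta> * sin \<phi>))" for h :: "real \<Rightarrow> real" and \<theta>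
  \<comment> \<open>The defect of the claimed identity. It vanishes on polynomials and is controlled
    by the supremum norm on [-1, 1], with the constant 2 pi * (pi/2) + 2 pi, so uniform
    approximation of \<open>H\<close> finishes the proof.\<close>
  define D where "D h = integral {0..pi/2} (\<lambda>\<theta>. sin \<theta> * K h \<theta>) - pi * integral {-1..1} h" for h
  have contK: "continuous_on S (K h)" if "continuous_on UNIV h" for h S
    unfolding K_def
    by (rule continuous_on_circle_mean)
      (auto simp: case_prod_unfold intro!: continuous_on_compose2[OF that] continuous_on_mult continuous_on_sin continuous_on_fst continuous_on_snd continuous_on_id)
  have conth: "continuous_on S (\<lambda>\<phi>. h (c * sin \<phi>))" if "continuous_on UNIV h" for h :: "real \<Rightarrow> real" and c S
    by (rule continuous_on_compose2[OF that]) (intro continuous_intros, auto)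
  have poly: "D (\<lambda>x. \<Sum>i\<le>n. a i * x ^ i) = 0" for a and n :: nat
  proof -
    let ?p = "\<lambda>x::real. \<Sum>i\<le>n. a i * x ^ i"
    let ?J = "\<lambda>i. integral {0..2*pi} (\<lambda>x. sin x ^ i) :: real"
    have int: "(\<lambda>x::real. c * sin x ^ i) integrable_on {a..b}" for c i a b
      by (intro integrable_continuous_real continuous_intros)
    have "K ?p \<theta> = (\<Sum>i\<le>n. a i * ?J i * sin \<theta> ^ i)" for \<theta>
    proof -
      have "K ?p \<theta> = integral {0..2*pi} (\<lambda>\<phi>. \<Sum>i\<le>n. (a i * sin \<theta> ^ i) * sin \<phi> ^ i)"
        unfolding K_def by (simp add: power_mult_distrib mult.assoc)
      also have "\<dots> = (\<Sum>i\<le>n. integral {0..2*pi} (\<lambda>\<phi>. (a i * sin \<theta> ^ i) * sin \<phi> ^ i))"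
        by (rule integral_sum[OF finite_atMost int])
      finally show ?thesis by (simp add: mult_ac)
    qed
    then have "integral {0..pi/2} (\<lambda>\<theta>. sin \<theta> * K ?p \<theta>)
        = integral {0..pi/2} (\<lambda>\<theta>. \<Sum>i\<le>n. (a i * ?J i) * sin \<theta> ^ (i+1))"
      by (simp add: sum_distrib_left mult_ac)
    also have "\<dots> = (\<Sum>i\<le>n. integral {0..pi/2} (\<lambda>\<theta>. (a i * ?J i) * sin \<theta> ^ (i+1)))"
      by (rule integral_sum[OF finite_atMost int])
    also have "\<dots> = (\<Sum>i\<le>n. a i * (?J i * integral {0..pi/2} (\<lambda>\<theta>. sin \<theta> ^ (i+1))))"
      by (simp only: integral_mult_right mult.assoc)
    also have "\<dots> = (\<Sum>i\<le>n. pi * integral {-1..1} (\<lambda>z. a i * z ^ i))"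
      unfolding integral_sin_powers_product by (simp add: mult_ac)
    also have "\<dots> = pi * integral {-1..1} ?p"
      by (subst integral_sum)
        (auto simp: sum_distrib_left intro!: integrable_continuous_real continuous_on_mult continuous_on_power continuous_on_id)
    finally show ?thesis unfolding D_def by simp
  qed
  have bound: "\<bar>D H\<bar> \<le> (pi\<^sup>2 + 2 * pi) * e" if e: "e > 0" for e
  proof -
    obtain p where p: "real_polynomial_function p" "\<And>x. x \<in> {-1..1} \<Longrightarrow> \<bar>H x - p x\<bar> < e"
      using Stone_Weierstrass_real_polynomial_function[of "{-1..1}" H e] H e
      by (metis compact_Icc continuous_on_subset subset_UNIV)
    obtain a n where pn: "p = (\<lambda>x. \<Sum>i\<le>n. a i * x ^ i)"
      using p(1) by (auto simp: real_polynomial_function_iff_sum)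
    have contp: "continuous_on UNIV p"
      unfolding pn by (intro continuous_intros)
    have K: "\<bar>K H \<theta> - K p \<theta>\<bar> \<le> 2 * pi * e" for \<theta>
    proof -
      have "K H \<theta> - K p \<theta> = integral {0..2*pi} (\<lambda>\<phi>. H (sin \<theta> * sin \<phi>) - p (sin \<theta> * sin \<phi>))"
        unfolding K_def
        by (intro integral_diff[symmetric] integrable_continuous_real conth H contp)
      moreover have "norm (integral {0..2*pi} (\<lambda>\<phi>. H (sin \<theta> * sin \<phi>) - p (sin \<theta> * sin \<phi>))) \<le> e * (2*pi - 0)"
      proof (rule integral_bound)
        fix t
        have "\<bar>sin \<theta> * sin t\<bar> \<le> 1"
          by (simp add: abs_mult mult_le_one)
        then show "norm (H (sin \<theta> * sin t) - p (sin \<theta> * sin t)) \<le> e"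
          using p(2)[of "sin \<theta> * sin t"] by (auto simp: abs_le_iff)
      qed (intro continuous_on_diff conth H contp | simp)+
      ultimately show ?thesis by (simp add: mult_ac)
    qed
    have "D H = D H - D p" unfolding pn poly by simp
    also have "\<dots> = integral {0..pi/2} (\<lambda>\<theta>. sin \<theta> * K H \<theta> - sin \<theta> * K p \<theta>) - pi * integral {-1..1} (\<lambda>z. H z - p z)"
      unfolding D_def
      by (subst (1 2) integral_diff)
         (auto simp: algebra_simps intro!: integrable_continuous_real continuous_on_mult contK H contp
            continuous_on_sin continuous_on_id intro: continuous_on_subset[OF H] continuous_on_subset[OF contp])
    finally have DH: "D H = \<dots>" .
    have "norm (integral {0..pi/2} (\<lambda>\<theta>. sin \<theta> * K H \<theta> - sin \<theta> * K p \<theta>)) \<le> (2*pi*e) * (pi/2 - 0)"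
    proof (rule integral_bound)
      fix t
      have "\<bar>sin t * K H t - sin t * K p t\<bar> = \<bar>sin t\<bar> * \<bar>K H t - K p t\<bar>"
        by (simp flip: abs_mult add: right_diff_distrib)
      also have "\<dots> \<le> 1 * (2*pi*e)"
        using K by (intro mult_mono) auto
      finally show "norm (sin t * K H t - sin t * K p t) \<le> 2*pi*e" by simp
    qed (intro continuous_intros contK H contp | simp)+
    moreover have "norm (integral {-1..1} (\<lambda>z. H z - p z)) \<le> e * (1 - (-1))"
    proof (rule integral_bound)
      show "norm (H t - p t) \<le> e" if "t \<in> {-1..1}" for t
        using p(2)[OF that] by simp
    qed (auto intro!: continuous_on_diff intro: continuous_on_subset[OF H] continuous_on_subset[OF contp])
    ultimately have "\<bar>D H\<bar> \<le> (2*pi*e) * (pi/2) + pi * (e * 2)"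
      unfolding DH by (intro order.trans[OF abs_triangle_ineq4] add_mono) (auto simp: abs_mult)
    then show ?thesis by (simp add: algebra_simps power2_eq_square)
  qed
  have "\<bar>D H\<bar> \<le> 0"
  proof (rule field_le_epsilon)
    fix e :: real assume e: "e > 0"
    have C: "pi\<^sup>2 + 2 * pi > 0" by (simp add: add_pos_pos)
    then show "\<bar>D H\<bar> \<le> 0 + e"
      using bound[of "e / (pi\<^sup>2 + 2 * pi)"] e by simp
  qed
  then show ?thesis unfolding D_def K_def by simp
qed

text \<open>Rescaling turns the hypothesis into the vanishing of the integral of \<open>H\<close>
  over [-r, r]; differentiating in r at r = 1 leaves the two boundary values.\<close>

lemma integral_symmetric_eq_zero:
  fixes H :: "real \<Rightarrow> real"
  assumes H: "continuous_on UNIV H"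
    and 0: "\<And>r. 0 < r \<Longrightarrow> r \<le> 1 \<Longrightarrow> integral {-1..1} (\<lambda>z. H (r * z)) = 0"
  shows "H 1 + H (-1) = 0"
proof -
  define \<Phi> where "\<Phi> r = integral {-2..r} H" for r
  have H': "continuous_on S H" for S using H by (rule continuous_on_subset) simp
  have int: "H integrable_on {a..b}" for a b
    by (intro integrable_continuous_real H')
  have der: "(\<Phi> has_real_derivative H x) (at x)" if "-2 < x" "x < 2" for x
    using integral_has_real_derivative[OF H', of x "-2" 2] that
    unfolding \<Phi>_def by (simp add: at_within_Icc_at)
  have eq: "\<Phi> r - \<Phi> (-r) = 0" if r: "0 < r" "r \<le> 1" for r
  proof -
    have "\<Phi> r = \<Phi> (-r) + integral {-r..r} H"
      unfolding \<Phi>_def using Henstock_Kurzweil_Integration.integral_combine[OF _ _ int, of "-2" "-r" r] r by simp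
    moreover have "((\<lambda>z. H (r *\<^sub>R z + 0)) has_integral (integral {-r..r} H /\<^sub>R r ^ DIM(real))) (cbox ((-r - 0) /\<^sub>R r) ((r - 0) /\<^sub>R r))"
      using has_integral_affinity_iff[of r H 0 "integral {-r..r} H" "-r" r] integrable_integral[OF int, of "-r" r] r by simp
    then have "integral {-1..1} (\<lambda>z. H (r * z)) = integral {-r..r} H / r"
      using r by (simp add: integral_unique divide_inverse_commute)
    ultimately show ?thesis using 0[OF r] r by simp
  qed
  have "((\<lambda>r. \<Phi> r - \<Phi> (-r)) has_real_derivative H 1 - H (-1) * (-1)) (at 1)"
    by (rule derivative_eq_intros der DERIV_chain2[where f = \<Phi> and g = uminus] | simp)+
  \<comment> \<open>The integral is known to vanish only for r at most 1, so the two derivatives are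
    compared one-sidedly, within [1/2, 1].\<close>
  then have "((\<lambda>r. \<Phi> r - \<Phi> (-r)) has_vector_derivative H 1 + H (-1)) (at 1 within cbox (1/2) 1)"
    by (simp add: has_real_derivative_iff_has_vector_derivative has_vector_derivative_at_within)
  moreover have "((\<lambda>r. \<Phi> r - \<Phi> (-r)) has_vector_derivative 0) (at 1 within cbox (1/2) 1)"
    by (rule has_vector_derivative_transform[where f = "\<lambda>_. 0"]) (auto simp: eq)
  ultimately show ?thesis
    by (intro vector_derivative_unique_within_closed_interval[of "1/2" 1 1]) auto
qed

text \<open>Averaging \<open>h\<close> over the rotations about \<open>v\<close> gives a zonal function \<open>H\<close>, whose circle integrals
  still vanish.\<close>

theorem great_circle_integrals_eq_zero_imp_odd:
  fixes h :: "'a::euclidean_space \<Rightarrow> real"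
  assumes h: "continuous_on UNIV h"
    and circ: "\<And>p q. norm p = 1 \<Longrightarrow> norm q = 1 \<Longrightarrow> p \<bullet> q = 0 \<Longrightarrow>
        integral {0..2*pi} (\<lambda>\<phi>. h (cos \<phi> *\<^sub>R p + sin \<phi> *\<^sub>R q)) = 0"
    and vxy: "norm v = 1" "norm x = 1" "norm y = 1" "v \<bullet> x = 0" "v \<bullet> y = 0" "x \<bullet> y = 0"
  shows "h v + h (-v) = 0"
proof -
  have [simp]: "v \<bullet> v = 1" "x \<bullet> x = 1" "y \<bullet> y = 1" "x \<bullet> v = 0" "y \<bullet> v = 0" "y \<bullet> x = 0"
    and [simp]: "v \<bullet> x = 0" "v \<bullet> y = 0" "x \<bullet> y = 0"
    using vxy by (simp_all add: norm_eq_1 inner_commute)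
  define E where "E c = Re c *\<^sub>R x + Im c *\<^sub>R y" for c
  define A where "A z c = h (z *\<^sub>R v + sqrt (1 - z\<^sup>2) *\<^sub>R E c)" for z c
  define H where "H z = integral {0..2*pi} (\<lambda>\<psi>. A z (cis \<psi>))" for z
  have contE: "continuous_on UNIV E"
    unfolding E_def by (intro continuous_intros)
  have contA: "continuous_on UNIV (A z)" for z
    unfolding A_def by (rule continuous_on_compose2[OF h]) (intro continuous_intros contE, auto)
  have contH: "continuous_on UNIV H"
    unfolding H_def
    by (rule continuous_on_circle_mean)
       (auto simp: case_prod_unfold A_def E_def intro!: continuous_on_compose2[OF h] continuous_intros)
  have KH: "integral {0..2*pi} (\<lambda>\<phi>. H (s * sin \<phi>)) = 0" if s: "\<bar>s\<bar> \<le> 1" for s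
  proof -
    define \<theta> where "\<theta> = arcsin s"
    have \<theta>: "sin \<theta> = s" using s by (simp add: \<theta>_def abs_le_iff)
    \<comment> \<open>A two-parameter family: for fixed \<psi> it traces in \<phi> a great circle
      whose greatest height over the equator is s, and for fixed \<phi> it traces in \<psi> the
      circle of latitude at height \<open>s * sin \<phi>\<close>. Exchanging the order of
      integration relates \<open>H\<close> to the vanishing great circle integrals.\<close>
    define P where "P \<phi> \<psi> = cos \<phi> *\<^sub>R E (cis \<psi>) + sin \<phi> *\<^sub>R (sin \<theta> *\<^sub>R v + cos \<theta> *\<^sub>R E (\<i> * cis \<psi>))" for \<phi> \<psi>
    have "integral {0..2*pi} (\<lambda>\<psi>. h (P \<phi> \<psi>)) = H (s * sin \<phi>)" for \<phi>
    proof -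
      define z where "z = s * sin \<phi>"
      \<comment> \<open>In the frame turning with \<psi>, b is the component of the point
        perpendicular to v. Its argument only moves the starting point on the circle of latitude,
        which \<open>integral_circle_rotate\<close> ignores.\<close>
      define b where "b = Complex (cos \<phi>) (sin \<phi> * cos \<theta>)"
      have "(norm b)\<^sup>2 = (cos \<phi>)\<^sup>2 + (sin \<phi>)\<^sup>2 * (cos \<theta>)\<^sup>2"
        by (simp add: b_def cmod_power2 power_mult_distrib)
      also have "\<dots> = 1 - z\<^sup>2"
        by (simp add: z_def power_mult_distrib flip: \<theta>) (simp add: cos_squared_eq algebra_simps)
      finally have nb: "norm b = sqrt (1 - z\<^sup>2)"
        by (simp add: real_sqrt_unique)
      obtain c where c: "norm c = 1" "b = sqrt (1 - z\<^sup>2) *\<^sub>R c"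
      proof (cases "b = 0")
        case True
        then show ?thesis using that[of 1] nb by simp
      next
        case False
        then show ?thesis
          by (intro that[of "sgn b"]) (simp add: norm_sgn, simp add: sgn_div_norm nb[symmetric])
      qed
      have "P \<phi> \<psi> = z *\<^sub>R v + sqrt (1 - z\<^sup>2) *\<^sub>R E (c * cis \<psi>)" for \<psi>
      proof -
        have "P \<phi> \<psi> = z *\<^sub>R v + E (b * cis \<psi>)"
          by (simp add: P_def E_def z_def b_def \<theta> algebra_simps)
        also have "E (b * cis \<psi>) = sqrt (1 - z\<^sup>2) *\<^sub>R E (c * cis \<psi>)"
          unfolding c(2) E_def by (simp add: algebra_simps)
        finally show ?thesis .
      qed
      then have "integral {0..2*pi} (\<lambda>\<psi>. h (P \<phi> \<psi>)) = integral {0..2*pi} (\<lambda>\<psi>. A z (c * cis \<psi>))"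
        by (simp add: A_def)
      also have "\<dots> = H z" unfolding H_def by (rule integral_circle_rotate[OF contA c(1)])
      finally show ?thesis by (simp add: z_def)
    qed
    then have "integral {0..2*pi} (\<lambda>\<phi>. H (s * sin \<phi>)) = integral {0..2*pi} (\<lambda>\<phi>. integral {0..2*pi} (\<lambda>\<psi>. h (P \<phi> \<psi>)))"
      by simp
    also have "\<dots> = integral {0..2*pi} (\<lambda>\<psi>. integral {0..2*pi} (\<lambda>\<phi>. h (P \<phi> \<psi>)))"
    proof -
      have "continuous_on (cbox (0, 0) (2*pi, 2*pi)) (\<lambda>(\<phi>, \<psi>). h (P \<phi> \<psi>))"
        by (auto simp: case_prod_unfold P_def E_def intro!: continuous_on_compose2[OF h] continuous_intros)
      from integral_swap_continuous[OF this] show ?thesis by (simp only: cbox_interval)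
    qed
    also have "(\<lambda>\<psi>. integral {0..2*pi} (\<lambda>\<phi>. h (P \<phi> \<psi>))) = (\<lambda>_. 0)"
    proof
      fix \<psi>
      have "norm (E (cis \<psi>)) = 1"
        by (simp add: norm_eq_1 E_def inner_add_left inner_add_right flip: power2_eq_square)
      moreover have "E (cis \<psi>) \<bullet> (sin \<theta> *\<^sub>R v + cos \<theta> *\<^sub>R E (\<i> * cis \<psi>)) = 0"
        by (simp add: E_def inner_add_left inner_add_right algebra_simps)
      moreover have "norm (sin \<theta> *\<^sub>R v + cos \<theta> *\<^sub>R E (\<i> * cis \<psi>)) = 1"
      proof -
        have "(sin \<theta> *\<^sub>R v + cos \<theta> *\<^sub>R E (\<i> * cis \<psi>)) \<bullet> (sin \<theta> *\<^sub>R v + cos \<theta> *\<^sub>R E (\<i> * cis \<psi>))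
          = (sin \<theta>)\<^sup>2 + (cos \<theta>)\<^sup>2 * ((sin \<psi>)\<^sup>2 + (cos \<psi>)\<^sup>2)"
          by (simp add: E_def inner_add_left inner_add_right algebra_simps power2_eq_square
              del: sin_cos_squared_add sin_cos_squared_add2 sin_cos_squared_add3)
        also have "\<dots> = 1" by (simp only: sin_cos_squared_add mult_1_right)
        finally show ?thesis by (simp only: norm_eq_1)
      qed
      ultimately show "integral {0..2*pi} (\<lambda>\<phi>. h (P \<phi> \<psi>)) = 0"
        unfolding P_def using circ by blast
    qed
    finally show ?thesis by simp
  qed
  have "integral {-1..1} (\<lambda>z. H (r * z)) = 0" if r: "0 < r" "r \<le> 1" for r
  proof -
    have "continuous_on UNIV (\<lambda>z. H (r * z))"
      by (rule continuous_on_compose2[OF contH]) (intro continuous_intros, auto)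
    then have "pi * integral {-1..1} (\<lambda>z. H (r * z))
       = integral {0..pi/2} (\<lambda>\<theta>. sin \<theta> * integral {0..2*pi} (\<lambda>\<phi>. H (r * (sin \<theta> * sin \<phi>))))"
      by (rule hemisphere_integral[symmetric])
    also have "(\<lambda>\<theta>. sin \<theta> * integral {0..2*pi} (\<lambda>\<phi>. H (r * (sin \<theta> * sin \<phi>)))) = (\<lambda>_. 0)"
      using KH[of "r * sin _"] r by (auto simp: mult.assoc abs_mult mult_le_one)
    finally show ?thesis by simp
  qed
  then have "H 1 + H (-1) = 0" by (rule integral_symmetric_eq_zero[OF contH])
  \<comment> \<open>At the heights 1 and -1 the circle of latitude shrinks to a point, so the mean
    \<open>H\<close> is 2 pi times the value of h there.\<close>
  then have "2 * pi * (h v + h (-v)) = 0"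
    by (simp add: H_def A_def algebra_simps)
  then show ?thesis by simp
qed

subsection \<open>Rotations of great circles\<close>

lemma periodic_int_multiple:
  fixes p :: "real \<Rightarrow> 'a"
  assumes "\<And>x. p (x + c) = p x"
  shows "p (x + of_int k * c) = p x"
proof (induction k rule: int_induct[where k = 0])
  case base
  show ?case by simp
next
  case (step1 i)
  then show ?case using assms[of "x + of_int i * c"] by (simp add: algebra_simps)
next
  case (step2 i)
  then show ?case using assms[of "x + of_int (i-1) * c"] by (simp add: algebra_simps)
qed

text \<open>Integer combinations of two periods with irrational ratio are dense, so x can be moved
  by periods arbitrarily close to y.\<close>

lemma continuous_two_periods_imp_constant:
  fixes p :: "real \<Rightarrow> real"
  assumes p: "continuous_on UNIV p" and d: "d > 0" "\<And>x. p (x + d) = p x"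
    and a: "\<And>x. p (x + a) = p x" "a / d \<notin> \<rat>"
  shows "p x = p y"
proof (rule ccontr)
  assume ne: "p x \<noteq> p y"
  have "isCont p y" using p by (simp add: continuous_on_eq_continuous_at)
  then obtain \<delta> where \<delta>: "\<delta> > 0" "\<And>z. \<bar>z - y\<bar> < \<delta> \<Longrightarrow> \<bar>p z - p y\<bar> < \<bar>p x - p y\<bar>"
    using ne unfolding continuous_at_eps_delta dist_real_def
    by (metis abs_minus_commute diff_gt_0_iff_gt eq_iff_diff_eq_0 zero_less_abs_iff)
  obtain h k where hk: "\<bar>of_int k * (a / d) - of_int h - (y - x) / d\<bar> < \<delta> / d"
    using sequence_of_fractional_parts_is_dense[OF a(2), of "\<delta> / d" "(y - x) / d"] \<delta>(1) d(1)
    by (metis divide_pos_pos)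
  define z where "z = x + of_int k * a + of_int (- h) * d"
  have "z - y = (of_int k * (a / d) - of_int h - (y - x) / d) * d"
    using d(1) by (simp add: z_def field_simps)
  then have "\<bar>z - y\<bar> = \<bar>of_int k * (a / d) - of_int h - (y - x) / d\<bar> * d"
    using d(1) by (simp add: abs_mult)
  also have "\<dots> < \<delta> / d * d" by (rule mult_strict_right_mono[OF hk d(1)])
  finally have "\<bar>z - y\<bar> < \<delta>" using d(1) by simp
  moreover have "p z = p x"
    unfolding z_def using periodic_int_multiple[of p, OF d(2)] periodic_int_multiple[of p, OF a(1)] by metis
  ultimately show False using \<delta>(2)[of z] by simp
qed

text \<open>Rodrigues' formula without its axial term: for a unit vector w this is the rotation
  about w only on vectors orthogonal to w, which is where it is applied.\<close>

definition rot3 :: "real ^ 3 \<Rightarrow> real \<Rightarrow> real ^ 3 \<Rightarrow> real ^ 3" where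
  "rot3 w \<alpha> v = cos \<alpha> *\<^sub>R v + sin \<alpha> *\<^sub>R cross3 w v"

lemma cross3_cross3_left: "cross3 (cross3 a b) c = (a \<bullet> c) *\<^sub>R b - (b \<bullet> c) *\<^sub>R a"
  by (simp add: cross3_simps forall_3)

lemma cross3_cross3_right: "cross3 a (cross3 b c) = (a \<bullet> c) *\<^sub>R b - (a \<bullet> b) *\<^sub>R c"
  by (simp add: cross3_simps forall_3)

lemma norm_cross3_orthogonal: "v \<bullet> w = 0 \<Longrightarrow> norm (cross3 w v) = norm w * norm v"
  using norm_cross_dot[of w v] by (simp add: inner_commute)

text \<open>Dividing the cross product by the signed number \<open>sin \<alpha>\<close> both
  normalises the axis and orients it so that the turn from v to u is by \<alpha> itself, not by
  -\<alpha>.\<close>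

lemma rot3_eq_of_inner:
  assumes "norm v = 1" "norm u = 1" "v \<bullet> u = cos \<alpha>" "sin \<alpha> \<noteq> 0"
  defines "w \<equiv> (1 / sin \<alpha>) *\<^sub>R cross3 v u"
  shows "norm w = 1" "v \<bullet> w = 0" "rot3 w \<alpha> v = u"
proof -
  have "(norm (cross3 v u))\<^sup>2 = (sin \<alpha>)\<^sup>2"
    using norm_cross_dot[of v u] assms by (simp add: sin_squared_eq)
  then have "norm (cross3 v u) = \<bar>sin \<alpha>\<bar>"
    using real_sqrt_unique[of "norm (cross3 v u)"] by simp
  then show "norm w = 1" using assms(4) by (simp add: w_def)
  show "v \<bullet> w = 0" by (simp add: w_def dot_cross_self)
  have "v \<bullet> v = 1" using assms(1) by (simp add: norm_eq_1)
  then show "rot3 w \<alpha> v = u"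
    using assms(3,4) by (simp add: rot3_def w_def cross_mult_left cross3_cross3_left inner_commute)
qed

text \<open>Both \<open>u\<close> and its mirror image in \<open>d\<^sup>\<bottom>\<close> are images of one point \<open>v\<close> of \<open>d\<^sup>\<bottom>\<close> under rotations about
  axes close to \<open>w0\<close>.\<close>

lemma eventually_eq_reflect:
  fixes F G :: "real ^ 3 \<Rightarrow> 'a"
  assumes w0: "norm w0 = 1" and u0: "norm u0 = 1" "u0 \<bullet> w0 = 0" and s: "sin \<alpha> \<noteq> 0" and e: "e > 0"
    and FG: "\<And>w v. norm w = 1 \<Longrightarrow> dist w w0 < e \<Longrightarrow> v \<bullet> w = 0 \<Longrightarrow> F (rot3 w \<alpha> v) = G v"
  shows "\<forall>\<^sub>F (u, d) in nhds u0 \<times>\<^sub>F nhds w0.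
           norm u = 1 \<longrightarrow> norm d = 1 \<longrightarrow> F (u - (2 * (u \<bullet> d)) *\<^sub>R d) = F u"
proof -
  let ?N = "nhds u0 \<times>\<^sub>F nhds w0"
  \<comment> \<open>Here m is the projection of u to the plane orthogonal to d, and v is sought in
    that plane as a combination of m and \<open>cross3 d m\<close>: x is fixed by the inner product
    \<open>cos \<alpha>\<close> with u, y2 by unit length. The sign of \<open>sin \<alpha>\<close>
    selects the solution that tends to u0 turned by -\<alpha> about w0.\<close>
  define m where "m = (\<lambda>(u :: real^3, d). u - (u \<bullet> d) *\<^sub>R d)"
  define x where "x p = cos \<alpha> / (m p \<bullet> m p)" for p
  define y2 where "y2 p = 1 / (m p \<bullet> m p) - (x p)\<^sup>2" for p
  define v where "v p = x p *\<^sub>R m p - (sgn (sin \<alpha>) * sqrt (y2 p)) *\<^sub>R cross3 (snd p) (m p)" for p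
  \<comment> \<open>The axes of the turns by \<alpha> from v to u and from v to the mirror image of
    u. As v is orthogonal to d, its inner products with both are equal; as (u, d) tends to (u0, w0),
    both axes tend to w0.\<close>
  define w where "w p = (1 / sin \<alpha>) *\<^sub>R cross3 (v p) (fst p)" for p
  define w' where "w' p = (1 / sin \<alpha>) *\<^sub>R cross3 (v p) (fst p - (2 * (fst p \<bullet> snd p)) *\<^sub>R snd p)" for p
  have f: "(fst \<longlongrightarrow> u0) ?N" and sn: "(snd \<longlongrightarrow> w0) ?N"
    by (rule filterlim_fst, rule filterlim_snd)
  have u0u0: "u0 \<bullet> u0 = 1" using u0 by (simp add: norm_eq_1)
  have cr: "((\<lambda>p. cross3 (a p) (b p)) \<longlongrightarrow> cross3 a0 b0) ?N" 
    if "(a \<longlongrightarrow> a0) ?N" "(b \<longlongrightarrow> b0) ?N" for a b a0 b0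
    using that by (rule bounded_bilinear.tendsto[OF bilinear_conv_bounded_bilinear[THEN iffD1, OF bilinear_cross]])
  have m: "(m \<longlongrightarrow> u0) ?N"
    using tendsto_diff[OF f tendsto_scaleR[OF tendsto_inner[OF f sn] sn]] u0 
    by (simp add: m_def case_prod_unfold)
  have mm: "((\<lambda>p. m p \<bullet> m p) \<longlongrightarrow> 1) ?N"
    using tendsto_inner[OF m m] u0u0 by simp
  have x: "(x \<longlongrightarrow> cos \<alpha>) ?N"
    unfolding x_def using tendsto_divide[OF tendsto_const mm] by simp
  have y2: "(y2 \<longlongrightarrow> (sin \<alpha>)\<^sup>2) ?N"
    unfolding y2_def sin_squared_eq using tendsto_diff[OF tendsto_divide[OF tendsto_const mm] tendsto_power[OF x]] by simp
  have "(v \<longlongrightarrow> cos \<alpha> *\<^sub>R u0 - (sgn (sin \<alpha>) * sqrt ((sin \<alpha>)\<^sup>2)) *\<^sub>R cross3 w0 u0) ?N"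
    unfolding v_def
    by (intro tendsto_intros x m sn y2 cr)
  then have v: "(v \<longlongrightarrow> cos \<alpha> *\<^sub>R u0 - sin \<alpha> *\<^sub>R cross3 w0 u0) ?N"
    using s by (simp add: sgn_if split: if_splits)
  have lim: "(1 / sin \<alpha>) *\<^sub>R cross3 (cos \<alpha> *\<^sub>R u0 - sin \<alpha> *\<^sub>R cross3 w0 u0) u0 = w0"
    using s u0 u0u0 by (simp add: Cross3.left_diff_distrib cross_mult_left cross3_cross3_left inner_commute)
  have w: "(w \<longlongrightarrow> w0) ?N"
    using tendsto_scaleR[OF tendsto_const cr[OF v f], of "1 / sin \<alpha>"] unfolding lim w_def .
  have "((\<lambda>p. fst p - (2 * (fst p \<bullet> snd p)) *\<^sub>R snd p) \<longlongrightarrow> u0 - (2 * (u0 \<bullet> w0)) *\<^sub>R w0) ?N"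
    by (intro tendsto_intros f sn)
  then have "((\<lambda>p. fst p - (2 * (fst p \<bullet> snd p)) *\<^sub>R snd p) \<longlongrightarrow> u0) ?N" using u0 by simp
  from tendsto_scaleR[OF tendsto_const cr[OF v this], of "1 / sin \<alpha>"]
  have w': "(w' \<longlongrightarrow> w0) ?N" unfolding lim w'_def .
  have "\<forall>\<^sub>F p in ?N. m p \<bullet> m p > 0" "\<forall>\<^sub>F p in ?N. y2 p > 0"
    using order_tendstoD(1)[OF mm, of 0] order_tendstoD(1)[OF y2, of 0] s by auto
  moreover have "\<forall>\<^sub>F p in ?N. dist (w p) w0 < e" "\<forall>\<^sub>F p in ?N. dist (w' p) w0 < e"
    using tendstoD[OF w e] tendstoD[OF w' e] by auto
  ultimately have "\<forall>\<^sub>F p in ?N. norm (fst p) = 1 \<longrightarrow> norm (snd p) = 1 \<longrightarrow>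
     F (fst p - (2 * (fst p \<bullet> snd p)) *\<^sub>R snd p) = F (fst p)"
  proof eventually_elim
    case (elim p)
    show ?case
    proof (intro impI)
      assume n: "norm (fst p) = 1" "norm (snd p) = 1"
      let ?u = "fst p" and ?d = "snd p"
      let ?u' = "?u - (2 * (?u \<bullet> ?d)) *\<^sub>R ?d"
      have n1: "?u \<bullet> ?u = 1" "?d \<bullet> ?d = 1" using n by (simp_all add: norm_eq_1)
      have md: "m p \<bullet> ?d = 0" and mu: "m p \<bullet> ?u = m p \<bullet> m p"
        by (simp_all add: m_def case_prod_unfold inner_diff_left inner_diff_right n1 inner_commute)
      have vd: "v p \<bullet> ?d = 0"
        by (simp add: v_def inner_diff_left md dot_cross_self)
      have cmu: "cross3 ?d (m p) \<bullet> ?u = 0"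
        by (simp add: m_def case_prod_unfold Cross3.right_diff_distrib cross_mult_right dot_cross_self)
      have vu: "v p \<bullet> ?u = cos \<alpha>"
        using elim by (simp add: v_def inner_diff_left mu cmu x_def)
      have "(norm (cross3 ?d (m p)))\<^sup>2 = m p \<bullet> m p"
        using norm_cross3_orthogonal[OF md] n by (simp add: power2_norm_eq_inner)
      then have cc: "cross3 ?d (m p) \<bullet> cross3 ?d (m p) = m p \<bullet> m p"
        by (simp add: power2_norm_eq_inner)
      have sq: "(a *\<^sub>R M - c *\<^sub>R N) \<bullet> (a *\<^sub>R M - c *\<^sub>R N) = a\<^sup>2 * (M \<bullet> M) + c\<^sup>2 * (N \<bullet> N)"
        if "M \<bullet> N = 0" for a c and M N :: "real ^ 3"
        using that by (simp add: inner_diff_left inner_diff_right inner_commute power2_eq_square)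
      have "(sgn (sin \<alpha>) * sqrt (y2 p))\<^sup>2 = y2 p"
        using elim s by (simp add: power_mult_distrib sgn_if)
      then have "v p \<bullet> v p = ((x p)\<^sup>2 + y2 p) * (m p \<bullet> m p)"
        unfolding v_def by (subst sq) (simp_all only: dot_cross_self cc distrib_right)
      also have "\<dots> = 1" using elim by (simp add: y2_def)
      finally have vn: "norm (v p) = 1" by (simp add: norm_eq_1)
      have vu': "v p \<bullet> ?u' = cos \<alpha>" by (simp add: inner_diff_right vd vu)
      have "?u' \<bullet> ?u' = 1" by (simp add: inner_diff_left inner_diff_right n1 inner_commute algebra_simps)
      then have nu': "norm ?u' = 1" by (simp add: norm_eq_1)
      have "F ?u = G (v p)"
        using rot3_eq_of_inner[OF vn n(1) vu s] FG elim(3) unfolding w_def by metis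
      moreover have "F ?u' = G (v p)"
        using rot3_eq_of_inner[OF vn nu' vu' s] FG elim(4) unfolding w'_def by metis
      ultimately show "F ?u' = F ?u" by simp
    qed
  qed
  then show ?thesis by (simp add: case_prod_unfold)
qed

lemma rot3_scale: "rot3 w \<alpha> (c *\<^sub>R v) = c *\<^sub>R rot3 w \<alpha> v"
  by (simp add: rot3_def cross_mult_right scaleR_add_right mult.commute)

lemma rot3_minus: "rot3 w \<alpha> (- v) = - rot3 w \<alpha> v"
  using rot3_scale[of w \<alpha> "-1" v] by simp

lemma inner_rot3_axis: "v \<bullet> w = 0 \<Longrightarrow> rot3 w \<alpha> v \<bullet> w = 0"
  by (simp add: rot3_def inner_add_left dot_cross_self)

lemma rot3_rot3:
  assumes "norm w = 1" "v \<bullet> w = 0"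
  shows "rot3 w \<alpha> (rot3 w \<beta> v) = rot3 w (\<alpha> + \<beta>) v"
proof -
  have "w \<bullet> w = 1" using assms(1) by (simp add: norm_eq_1)
  then have "cross3 w (cross3 w v) = - v"
    using assms(2) by (simp add: cross3_cross3_right inner_commute)
  then show ?thesis
    by (simp add: rot3_def cos_add sin_add cross_add_right cross_mult_right scaleR_add_right
        scaleR_add_left scaleR_diff_left algebra_simps)
qed

lemma norm_rot3:
  assumes "norm w = 1" "v \<bullet> w = 0"
  shows "norm (rot3 w \<alpha> v) = norm v"
proof -
  have "cross3 w v \<bullet> cross3 w v = v \<bullet> v"
    using norm_cross3_orthogonal[OF assms(2)] assms(1) by (simp flip: power2_norm_eq_inner)
  then have "rot3 w \<alpha> v \<bullet> rot3 w \<alpha> v = ((cos \<alpha>)\<^sup>2 + (sin \<alpha>)\<^sup>2) * (v \<bullet> v)"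
    by (simp add: rot3_def inner_add_left inner_add_right dot_cross_self power2_eq_square distrib_right
        del: sin_cos_squared_add sin_cos_squared_add2 sin_cos_squared_add3)
  then show ?thesis by (simp add: norm_eq_sqrt_inner)
qed

text \<open>Parametrising the orthogonal plane by the cross product removes the dependence on w from
  the range of the quantifier. Conditions quantified over that plane then become intersections of
  closed sets.\<close>

lemma ball_orthogonal_iff_cross3:
  assumes "norm w = 1"
  shows "(\<forall>v. v \<bullet> w = 0 \<longrightarrow> P v) \<longleftrightarrow> (\<forall>x. P (cross3 w x))"
proof (intro iffI allI impI)
  fix v assume "\<forall>x. P (cross3 w x)" "v \<bullet> w = 0"
  moreover have "cross3 w (cross3 v w) = v"
    using assms \<open>v \<bullet> w = 0\<close> by (simp add: cross3_cross3_right inner_commute norm_eq_1)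
  ultimately show "P v" by metis
qed (simp add: dot_cross_self)

lemma orthogonal_unit_exists:
  obtains w :: "real ^ 3" where "norm w = 1" "a \<bullet> w = 0" "b \<bullet> w = 0"
proof -
  have "dim {a, b} \<le> card {a, b}" by (rule dim_le_card) (auto intro: span_base)
  also have "\<dots> \<le> 2" by (simp add: card_insert_if)
  finally have "dim {a, b} < DIM(real ^ 3)" by simp
  then obtain x where x: "x \<noteq> 0" "\<And>y. y \<in> span {a, b} \<Longrightarrow> orthogonal x y"
    using orthogonal_to_subspace_exists by blast
  have "a \<bullet> x = 0" "b \<bullet> x = 0"
    using x(2)[of a] x(2)[of b] by (auto simp: span_base orthogonal_def inner_commute)
  then show thesis using that[of "sgn x"] x(1) by (simp add: norm_sgn sgn_div_norm)
qed

text \<open>The mirror is the perpendicular bisector of the segment from u to u', which passes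
  through 0 because both are unit vectors.\<close>

lemma reflect_sgn_diff:
  fixes u u' :: "'a::real_inner"
  assumes "norm u = 1" "norm u' = 1" "u' \<noteq> u"
  shows "u - (2 * (u \<bullet> sgn (u' - u))) *\<^sub>R sgn (u' - u) = u'"
proof -
  have 1: "u \<bullet> u = 1" "u' \<bullet> u' = 1" using assms by (simp_all add: norm_eq_1)
  have "(norm (u' - u))\<^sup>2 = - 2 * (u \<bullet> (u' - u))"
    by (simp add: power2_norm_eq_inner inner_diff_left inner_diff_right 1 inner_commute)
  then have N: "2 * (u \<bullet> (u' - u)) = - (norm (u' - u) * norm (u' - u))"
    by (simp add: power2_eq_square)
  have "-1 = 2 * (u \<bullet> (u' - u)) / (norm (u' - u) * norm (u' - u))"
    unfolding N using assms(3) by simp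
  then have "(2 * (u \<bullet> sgn (u' - u))) *\<^sub>R sgn (u' - u) = (-1) *\<^sub>R (u' - u)"
    by (simp add: sgn_div_norm divide_inverse mult_ac)
  then show ?thesis by simp
qed

text \<open>Two points near \<open>u0\<close> on the circle are mirror images of a common third point slightly off the
  circle.\<close>

lemma eventually_eq_on_circle:
  fixes F G :: "real ^ 3 \<Rightarrow> 'a"
  assumes w0: "norm w0 = 1" and u0: "norm u0 = 1" "u0 \<bullet> w0 = 0" and s: "sin \<alpha> \<noteq> 0" and e: "e > 0"
    and FG: "\<And>w v. norm w = 1 \<Longrightarrow> dist w w0 < e \<Longrightarrow> v \<bullet> w = 0 \<Longrightarrow> F (rot3 w \<alpha> v) = G v"
  shows "\<forall>\<^sub>F u in nhds u0. norm u = 1 \<longrightarrow> F u = F u0"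
proof -
  obtain U V where "\<forall>\<^sub>F u in nhds u0. U u" "\<forall>\<^sub>F d in nhds w0. V d"
    and refl': "\<And>u d. U u \<Longrightarrow> V d \<Longrightarrow> norm u = 1 \<Longrightarrow> norm d = 1 \<Longrightarrow> F (u - (2 * (u \<bullet> d)) *\<^sub>R d) = F u"
    using eventually_eq_reflect[of w0 u0 \<alpha> e F G] assms unfolding eventually_prod_filter by auto
  then obtain V' where V': "open V'" "w0 \<in> V'" "\<And>d. d \<in> V' \<Longrightarrow> V d" and U: "\<forall>\<^sub>F u in nhds u0. U u"
    by (auto simp: eventually_nhds)
  note refl = refl'[OF _ V'(3)]
  have 1: "u0 \<bullet> u0 = 1" "w0 \<bullet> w0 = 1" "w0 \<bullet> u0 = 0" using u0 w0 by (simp_all add: norm_eq_1 inner_commute)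
  have "((\<lambda>\<eta>. cos \<eta> *\<^sub>R w0 - sin \<eta> *\<^sub>R u0) \<longlongrightarrow> cos 0 *\<^sub>R w0 - sin 0 *\<^sub>R u0) (at_right 0)"
    by (intro tendsto_intros)
  then have "\<forall>\<^sub>F \<eta> in at_right 0. cos \<eta> *\<^sub>R w0 - sin \<eta> *\<^sub>R u0 \<in> V'"
    using V'(1,2) by (intro topological_tendstoD) auto
  moreover have "\<forall>\<^sub>F \<eta> in at_right (0::real). 0 < \<eta> \<and> \<eta> < pi"
    using eventually_at_right_real[of 0 pi] by simp
  ultimately obtain \<eta> where \<eta>: "0 < \<eta>" "\<eta> < pi" "cos \<eta> *\<^sub>R w0 - sin \<eta> *\<^sub>R u0 \<in> V'"
    using eventually_happens'[OF trivial_limit_at_right_real] by (metis (mono_tags, lifting) eventually_conj)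
  \<comment> \<open>Tilting w0 by a small \<eta> makes the mirror image u2 of u0 differ from u0 by a
    positive multiple of d0. For u near u0 the mirror carrying u to the same u2 has normal
    \<open>sgn (u2 - u)\<close>, still close to d0, so \<open>F u = F u2 = F u0\<close>.\<close>
  define d0 where "d0 = cos \<eta> *\<^sub>R w0 - sin \<eta> *\<^sub>R u0"
  define u2 where "u2 = u0 - (2 * (u0 \<bullet> d0)) *\<^sub>R d0"
  have sn: "sin \<eta> > 0" using \<eta> by (simp add: sin_gt_zero)
  have "d0 \<bullet> d0 = (cos \<eta>)\<^sup>2 + (sin \<eta>)\<^sup>2"
    using u0 by (simp add: d0_def inner_diff_left inner_diff_right 1 power2_eq_square
        del: sin_cos_squared_add sin_cos_squared_add2 sin_cos_squared_add3)
  then have d0: "d0 \<bullet> d0 = 1" "norm d0 = 1" by (simp_all add: norm_eq_1)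
  have u0d0: "u0 \<bullet> d0 = - sin \<eta>" using u0 by (simp add: d0_def inner_diff_right 1)
  have "u2 \<bullet> u2 = 1"
    by (simp add: u2_def inner_diff_left inner_diff_right d0 1 inner_commute algebra_simps)
  then have u2: "norm u2 = 1" by (simp add: norm_eq_1)
  have diff: "u2 - u0 = (2 * sin \<eta>) *\<^sub>R d0" by (simp add: u2_def u0d0)
  then have ne: "u2 - u0 \<noteq> 0" using sn d0 by auto
  have "((\<lambda>u. sgn (u2 - u)) \<longlongrightarrow> sgn (u2 - u0)) (nhds u0)"
    by (intro tendsto_intros filterlim_ident ne)
  moreover have "sgn (u2 - u0) = d0"
    unfolding diff using sn d0 by (simp add: sgn_scaleR sgn_div_norm)
  ultimately have "\<forall>\<^sub>F u in nhds u0. sgn (u2 - u) \<in> V'"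
    using V'(1) \<eta>(3) by (intro topological_tendstoD) (auto simp: d0_def)
  moreover have "\<forall>\<^sub>F u in nhds u0. u \<noteq> u2"
    using ne by (intro t1_space_nhds) auto
  ultimately show ?thesis
    using U
  proof eventually_elim
    case (elim u)
    show ?case
    proof
      assume u: "norm u = 1"
      have "F u = F u2"
        using refl[OF elim(3,1) u] reflect_sgn_diff[OF u u2] elim(2) by (auto simp: norm_sgn)
      also have "F u2 = F u0"
        unfolding u2_def using refl[OF eventually_nhds_x_imp_x[OF U] _ u0(1) d0(2)] \<eta>(3) by (simp add: d0_def)
      finally show "F u = F u0" .
    qed
  qed
qed


text \<open>Local constancy along the circle makes the derivative of F in the angle vanish
  identically, so F takes equal values at the angles 0 and pi. Rescaling by \<open>norm v\<close>
  reduces to unit vectors.\<close>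

lemma even_on_circle:
  fixes F G :: "real ^ 3 \<Rightarrow> real"
  assumes w0: "norm w0 = 1" and s: "sin \<alpha> \<noteq> 0" and e: "e > 0"
    and FG: "\<And>w v. norm w = 1 \<Longrightarrow> dist w w0 < e \<Longrightarrow> v \<bullet> w = 0 \<Longrightarrow> F (rot3 w \<alpha> v) = G v"
    and v: "v \<bullet> w0 = 0"
  shows "F (- v) = F v"
proof (cases "v = 0")
  case False
  define F' where "F' x = F (norm v *\<^sub>R x)" for x
  define G' where "G' x = G (norm v *\<^sub>R x)" for x
  have FG': "F' (rot3 w \<alpha> x) = G' x" if "norm w = 1" "dist w w0 < e" "x \<bullet> w = 0" for w x
    using FG[OF that(1,2), of "norm v *\<^sub>R x"] that(3) by (simp add: F'_def G'_def rot3_scale)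
  define c where "c \<phi> = rot3 w0 \<phi> (sgn v)" for \<phi>
  have sv: "sgn v \<bullet> w0 = 0" "norm (sgn v) = 1" using v False by (simp_all add: sgn_div_norm norm_sgn)
  have c: "norm (c \<phi>) = 1" "c \<phi> \<bullet> w0 = 0" for \<phi>
    unfolding c_def using norm_rot3[OF w0 sv(1)] inner_rot3_axis[OF sv(1)] sv(2) by auto
  have "((\<lambda>\<phi>. F' (c \<phi>)) has_real_derivative 0) (at \<phi>)" for \<phi>
  proof -
    have "(c \<longlongrightarrow> c \<phi>) (nhds \<phi>)"
      unfolding c_def rot3_def by (intro tendsto_intros filterlim_ident)
    then have "\<forall>\<^sub>F \<psi> in nhds \<phi>. norm (c \<psi>) = 1 \<longrightarrow> F' (c \<psi>) = F' (c \<phi>)"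
      using eventually_eq_on_circle[of w0 "c \<phi>" \<alpha> e F' G'] w0 c s e FG' by (auto simp: filterlim_iff)
    then show ?thesis
      using c by (subst DERIV_cong_ev[OF refl _ refl, where g = "\<lambda>_. F' (c \<phi>)"]) auto
  qed
  then have "F' (c pi) = F' (c 0)" using DERIV_isconst_all by blast
  then show ?thesis
    using False by (simp add: c_def rot3_def F'_def sgn_div_norm)
qed simp

section \<open>Even and odd parts of functions matched by rotations\<close>

lemma continuous_rot3:
  fixes a :: "'a::t2_space \<Rightarrow> real"
  assumes "continuous_on S a" "continuous_on S w" "continuous_on S v"
  shows "continuous_on S (\<lambda>x. rot3 (w x) (a x) (v x))"
  unfolding rot3_def using assms
  by (intro continuous_on_add continuous_on_scaleR continuous_on_sin continuous_on_cos continuous_on_cross)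

text \<open>A rotation of a circle preserves the integral over it. Hence F - G, restricted to a
  sphere of any radius, has vanishing great circle integrals and is odd there.\<close>

lemma great_circle_rotations_imp_even_parts_eq:
  fixes F G :: "real ^ 3 \<Rightarrow> real"
  assumes F: "continuous_on UNIV F" and G: "continuous_on UNIV G"
    and rot: "\<And>w. norm w = 1 \<Longrightarrow> \<exists>\<alpha>. \<forall>v. v \<bullet> w = 0 \<longrightarrow> F (rot3 w \<alpha> v) = G v"
  shows "F v + F (- v) = G v + G (- v)"
proof (cases "v = 0")
  case True
  obtain w :: "real ^ 3" where w: "norm w = 1" using orthogonal_unit_exists by blast
  obtain \<alpha> where "\<forall>v. v \<bullet> w = 0 \<longrightarrow> F (rot3 w \<alpha> v) = G v" using rot[OF w] by blast
  then have "F (rot3 w \<alpha> 0) = G 0" by simp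
  then show ?thesis using True by (simp add: rot3_def)
next
  case False
  define r where "r = norm v"
  define h where "h x = F (r *\<^sub>R x) - G (r *\<^sub>R x)" for x
  have h: "continuous_on UNIV h"
    unfolding h_def
    by (intro continuous_on_diff continuous_on_compose2[OF F] continuous_on_compose2[OF G] continuous_intros) auto
  obtain x :: "real ^ 3" where x: "norm x = 1" "v \<bullet> x = 0" using orthogonal_unit_exists by blast
  define y where "y = cross3 (sgn v) x"
  have sv: "norm (sgn v) = 1" "sgn v \<bullet> x = 0" using False x by (simp_all add: norm_sgn sgn_div_norm)
  have y: "norm y = 1" "sgn v \<bullet> y = 0" "x \<bullet> y = 0"
    using norm_cross3_orthogonal[of x "sgn v"] sv x by (simp_all add: y_def dot_cross_self inner_commute)
  have "integral {0..2*pi} (\<lambda>\<phi>. h (cos \<phi> *\<^sub>R p + sin \<phi> *\<^sub>R q)) = 0"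
    if pq: "norm p = 1" "norm q = 1" "p \<bullet> q = 0" for p q :: "real ^ 3"
  proof -
    \<comment> \<open>In this complex coordinate on the plane of p and q the rotation by \<alpha> is
      multiplication by \<open>cis \<alpha>\<close>.\<close>
    define E where "E c = Re c *\<^sub>R p + Im c *\<^sub>R q" for c
    define w where "w = cross3 p q"
    have w: "norm w = 1" using norm_cross3_orthogonal[of q p] pq by (simp add: w_def inner_commute)
    have "cross3 w p = q" "cross3 w q = - p"
      using pq by (simp_all add: w_def cross3_cross3_left norm_eq_1 inner_commute)
    then have rE: "rot3 w \<alpha> (E c) = E (cis \<alpha> * c)" for \<alpha> c
      by (simp add: rot3_def E_def cross_add_right cross_mult_right algebra_simps)
    have Ew: "E c \<bullet> w = 0" for c
      by (simp add: E_def w_def inner_add_left dot_cross_self)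
    obtain \<alpha> where \<alpha>: "\<And>v. v \<bullet> w = 0 \<Longrightarrow> F (rot3 w \<alpha> v) = G v" using rot[OF w] by blast
    have contE: "continuous_on UNIV (\<lambda>c. r *\<^sub>R E c)" unfolding E_def by (intro continuous_intros)
    have contF: "continuous_on UNIV (\<lambda>c. F (r *\<^sub>R E c))"
      by (rule continuous_on_compose2[OF F contE]) auto
    have contG: "continuous_on UNIV (\<lambda>c. G (r *\<^sub>R E c))"
      by (rule continuous_on_compose2[OF G contE]) auto
    have int: "(\<lambda>\<phi>. F (r *\<^sub>R E (cis \<phi>))) integrable_on {0..2*pi}" "(\<lambda>\<phi>. G (r *\<^sub>R E (cis \<phi>))) integrable_on {0..2*pi}"
      by (intro integrable_continuous_real continuous_on_compose2[OF contF] continuous_on_compose2[OF contG] continuous_intros; simp)+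
    have "integral {0..2*pi} (\<lambda>\<phi>. G (r *\<^sub>R E (cis \<phi>))) = integral {0..2*pi} (\<lambda>\<phi>. F (r *\<^sub>R E (cis \<alpha> * cis \<phi>)))"
      using \<alpha>[of "r *\<^sub>R E (cis _)"] by (simp add: rot3_scale rE Ew)
    also have "\<dots> = integral {0..2*pi} (\<lambda>\<phi>. F (r *\<^sub>R E (cis \<phi>)))"
      by (rule integral_circle_rotate[OF contF]) simp
    finally have "integral {0..2*pi} (\<lambda>\<phi>. F (r *\<^sub>R E (cis \<phi>)) - G (r *\<^sub>R E (cis \<phi>))) = 0"
      using integral_diff[OF int] by simp
    then show ?thesis by (simp add: h_def E_def)
  qed
  then have "h (sgn v) + h (- sgn v) = 0"
    by (rule great_circle_integrals_eq_zero_imp_odd[OF h _ sv(1) x(1) y(1) sv(2) y(2,3)])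
  then show ?thesis using False by (simp add: h_def r_def sgn_div_norm)
qed

text \<open>The squares of F and G are matched by the same rotations, so the even parts of the
  squares agree as well; and (a - b)^2 = 2 (a^2 + b^2) - (a + b)^2.\<close>

lemma great_circle_rotations_imp_odd_parts_abs_eq:
  fixes F G :: "real ^ 3 \<Rightarrow> real"
  assumes F: "continuous_on UNIV F" and G: "continuous_on UNIV G"
    and rot: "\<And>w. norm w = 1 \<Longrightarrow> \<exists>\<alpha>. \<forall>v. v \<bullet> w = 0 \<longrightarrow> F (rot3 w \<alpha> v) = G v"
  shows "\<bar>F v - F (- v)\<bar> = \<bar>G v - G (- v)\<bar>"
proof -
  have 1: "F v + F (- v) = G v + G (- v)"
    by (rule great_circle_rotations_imp_even_parts_eq[OF assms])
  have 2: "(F v)\<^sup>2 + (F (- v))\<^sup>2 = (G v)\<^sup>2 + (G (- v))\<^sup>2"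
  proof (rule great_circle_rotations_imp_even_parts_eq[of "\<lambda>v. (F v)\<^sup>2" "\<lambda>v. (G v)\<^sup>2"])
    fix w :: "real ^ 3" assume "norm w = 1"
    then obtain \<alpha> where "\<forall>v. v \<bullet> w = 0 \<longrightarrow> F (rot3 w \<alpha> v) = G v" using rot by blast
    then show "\<exists>\<alpha>. \<forall>v. v \<bullet> w = 0 \<longrightarrow> (F (rot3 w \<alpha> v))\<^sup>2 = (G v)\<^sup>2"
      by (intro exI[of _ \<alpha>]) simp
  qed (intro continuous_on_power F G)+
  have "(F v - F (- v))\<^sup>2 = 2 * ((F v)\<^sup>2 + (F (- v))\<^sup>2) - (F v + F (- v))\<^sup>2"
    by (simp add: power2_eq_square algebra_simps)
  also have "\<dots> = (G v - G (- v))\<^sup>2"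
    unfolding 1 2 by (simp add: power2_eq_square algebra_simps)
  finally show ?thesis by (simp add: power2_eq_iff abs_eq_iff)
qed

text \<open>Along the circle the absolute value of F v - F (-v) has the periods \<alpha> and 2 pi,
  hence is constant. The difference itself changes sign between opposite points, so it has a zero,
  and the constant is 0.\<close>

lemma irrational_rotation_imp_even:
  fixes F G :: "real ^ 3 \<Rightarrow> real"
  assumes F: "continuous_on UNIV F" and w: "norm w = 1"
    and rot: "\<And>v. v \<bullet> w = 0 \<Longrightarrow> F (rot3 w \<alpha> v) = G v"
    and abs: "\<And>v. \<bar>F v - F (- v)\<bar> = \<bar>G v - G (- v)\<bar>"
    and irr: "\<alpha> / (2 * pi) \<notin> \<rat>" and v: "v \<bullet> w = 0"
  shows "F (- v) = F v"
proof -
  define a where "a \<phi> = F (rot3 w \<phi> v) - F (- rot3 w \<phi> v)" for \<phi>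
  have a: "continuous_on S a" for S
    unfolding a_def
    by (intro continuous_on_diff continuous_on_compose2[OF F] continuous_on_minus continuous_rot3 continuous_intros) auto
  have "\<bar>a (\<phi> + \<alpha>)\<bar> = \<bar>a \<phi>\<bar>" for \<phi>
  proof -
    let ?x = "rot3 w \<phi> v"
    have x: "?x \<bullet> w = 0" "- ?x \<bullet> w = 0" using inner_rot3_axis[OF v] by auto
    have "a (\<phi> + \<alpha>) = F (rot3 w \<alpha> ?x) - F (rot3 w \<alpha> (- ?x))"
      by (simp add: a_def rot3_rot3[OF w v] rot3_minus add.commute)
    then show ?thesis using rot[OF x(1)] rot[OF x(2)] abs[of ?x] by (simp add: a_def)
  qed
  moreover have "\<bar>a (\<phi> + 2 * pi)\<bar> = \<bar>a \<phi>\<bar>" for \<phi> by (simp add: a_def rot3_def)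
  moreover have "continuous_on UNIV (\<lambda>\<phi>. \<bar>a \<phi>\<bar>)" by (intro continuous_on_rabs a)
  ultimately have const: "\<bar>a x\<bar> = \<bar>a y\<bar>" for x y
    using continuous_two_periods_imp_constant[of "\<lambda>x. \<bar>a x\<bar>" "2 * pi" \<alpha>] irr by simp
  have "a pi = - a 0" by (simp add: a_def rot3_def)
  then have "a 0 \<le> 0 \<and> 0 \<le> a pi \<or> a pi \<le> 0 \<and> 0 \<le> a 0" by linarith
  then obtain x where "a x = 0"
    using IVT'[of a 0 0 pi, OF _ _ _ a] IVT2'[of a pi 0 0, OF _ _ _ a] pi_ge_zero by blast
  then have "a 0 = 0" using const[of 0 x] by simp
  then show ?thesis by (simp add: a_def rot3_def)
qed

lemma closed_rotation_set:
  fixes F G :: "'i \<Rightarrow> real ^ 3 \<Rightarrow> real"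
  assumes F: "\<And>i. continuous_on UNIV (F i)" and G: "\<And>i. continuous_on UNIV (G i)"
  shows "closed {w. norm w = 1 \<and> (\<forall>v. v \<bullet> w = 0 \<longrightarrow> (\<forall>i. F i (rot3 w \<alpha> v) = G i v))}"
proof -
  have "closed {w. norm w = 1 \<and> (\<forall>x i. F i (rot3 w \<alpha> (cross3 w x)) = G i (cross3 w x))}"
    by (intro closed_Collect_conj closed_Collect_all closed_Collect_eq
        continuous_on_compose2[OF F] continuous_on_compose2[OF G] continuous_rot3 continuous_on_cross
        continuous_intros) auto
  then show ?thesis
    by (rule back_subst[of closed]) (simp add: ball_orthogonal_iff_cross3 cong: conj_cong)
qed

text \<open>A family of functions is treated at once because all slices share one angle on each
  circle, and the final alternative must be the same for all of them.\<close>

theorem great_circle_rotations: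
  fixes F G :: "'i \<Rightarrow> real ^ 3 \<Rightarrow> real"
  assumes F: "\<And>i. continuous_on UNIV (F i)" and G: "\<And>i. continuous_on UNIV (G i)"
    and rot: "\<And>w. norm w = 1 \<Longrightarrow> \<exists>\<alpha>. \<forall>v. v \<bullet> w = 0 \<longrightarrow> (\<forall>i. F i (rot3 w \<alpha> v) = G i v)"
  shows "(\<forall>i v. F i v = G i v) \<or> (\<forall>i v. F i v = G i (- v))"
proof -
  define T where "T \<alpha> = {w. norm w = 1 \<and> (\<forall>v. v \<bullet> w = 0 \<longrightarrow> (\<forall>i. F i (rot3 w \<alpha> v) = G i v))}" for \<alpha>
  define Z where "Z = {w. norm w = 1 \<and> (\<forall>v. v \<bullet> w = 0 \<longrightarrow> (\<forall>i. F i (rot3 w pi v) = F i v))}"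
  have clT: "closed (T \<alpha>)" for \<alpha> unfolding T_def by (rule closed_rotation_set[OF F G])
  have clZ: "closed Z" unfolding Z_def by (rule closed_rotation_set[OF F F])
  have r0: "rot3 w 0 v = v" "rot3 w pi v = - v" for w v by (simp_all add: rot3_def)
  have roti: "\<exists>\<alpha>. \<forall>v. v \<bullet> w = 0 \<longrightarrow> F i (rot3 w \<alpha> v) = G i v" if "norm w = 1" for w i
    using rot[OF that] by blast
  have even: "F i v + F i (- v) = G i v + G i (- v)" for i v
    by (rule great_circle_rotations_imp_even_parts_eq[OF F G roti])
  have odd: "\<bar>F i v - F i (- v)\<bar> = \<bar>G i v - G i (- v)\<bar>" for i v
    by (rule great_circle_rotations_imp_odd_parts_abs_eq[OF F G roti])
  \<comment> \<open>Where F is even along the circle, so is G by equality of the absolute odd parts,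
    and then the even parts give F = G there.\<close>
  have ZT: "Z \<subseteq> T 0"
  proof
    fix w assume w: "w \<in> Z"
    have "F i v = G i v" if "v \<bullet> w = 0" for i v
    proof -
      have "F i (- v) = F i v" using w that by (auto simp: Z_def r0)
      then show ?thesis using even[of i v] odd[of i v] by simp
    qed
    then show "w \<in> T 0" using w by (auto simp: T_def Z_def r0)
  qed
  have irr: "w \<in> Z" if "w \<in> T \<alpha>" "\<alpha> / (2 * pi) \<notin> \<rat>" for w \<alpha>
    using that irrational_rotation_imp_even[OF F, of w _ \<alpha> "G _", OF _ _ odd] by (auto simp: Z_def T_def r0)
  have sin0: "T \<alpha> \<subseteq> T 0 \<union> T pi" if "sin \<alpha> = 0" for \<alpha>
  proof -
    have "cos \<alpha> = 1 \<or> cos \<alpha> = -1" using sin_cos_squared_add[of \<alpha>] that by (simp add: power2_eq_1_iff)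
    then show ?thesis using that by (auto simp: T_def rot3_def)
  qed
  have cover: "w1 \<in> T 0 \<union> T pi" if w1: "norm w1 = 1" for w1
  proof (rule ccontr)
    assume n: "w1 \<notin> T 0 \<union> T pi"
    have "open (- (T 0 \<union> T pi))" by (intro open_Compl closed_Un clT)
    then obtain \<epsilon> where \<epsilon>: "\<epsilon> > 0" "cball w1 \<epsilon> \<subseteq> - (T 0 \<union> T pi)"
      using n open_contains_cball by (metis ComplI)
    define S where "S = sphere (0 :: real ^ 3) 1"
    \<comment> \<open>One relatively open set for each of the countably many angles that are
      rational multiples of pi. The closed ball stays away from the angles 0 and pi.\<close>
    define \<G> where "\<G> = (\<lambda>q. S - (T (2 * pi * q) \<inter> cball w1 \<epsilon>)) ` \<rat>"
    have "S \<subseteq> closure (\<Inter>\<G>)"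
    proof (rule Baire)
      show "closed S" by (simp add: S_def)
      show "countable \<G>" unfolding \<G>_def by (intro countable_image countable_rat)
      fix U assume "U \<in> \<G>"
      then obtain q where q: "U = S - (T (2 * pi * q) \<inter> cball w1 \<epsilon>)" by (auto simp: \<G>_def)
      have "closed (T (2 * pi * q) \<inter> cball w1 \<epsilon>)" using clT by (simp add: closed_Int)
      then have "closedin (top_of_set S) (T (2 * pi * q) \<inter> cball w1 \<epsilon>)"
        by (intro closed_subset) (auto simp: T_def S_def)
      then have "openin (top_of_set S) U" unfolding q by (intro openin_diff) simp_all
      \<comment> \<open>If this set were not dense, one angle with nonzero sine would serve all axes
        near some x in the ball; then \<open>even_on_circle\<close> puts x into \<open>Z\<close> and
        so into \<open>T 0\<close>, which the ball avoids.\<close>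
      moreover have "S \<subseteq> closure U"
      proof (rule ccontr)
        assume "\<not> S \<subseteq> closure U"
        then obtain x where x: "x \<in> S" "x \<notin> closure U" by blast
        then obtain \<delta> where \<delta>: "\<delta> > 0" "\<And>y. y \<in> U \<Longrightarrow> dist y x \<ge> \<delta>"
          by (metis closure_approachable linorder_not_le)
        have near: "w \<in> T (2 * pi * q) \<inter> cball w1 \<epsilon>" if "norm w = 1" "dist w x < \<delta>" for w
          using \<delta>(2)[of w] that by (auto simp: q S_def)
        have x1: "norm x = 1" using x by (simp add: S_def)
        then have xT: "x \<in> T (2 * pi * q) \<inter> cball w1 \<epsilon>" using near[of x] \<delta>(1) by simp
        have s: "sin (2 * pi * q) \<noteq> 0"
          using xT \<epsilon>(2) sin0 by blast
        have "F i (- v) = F i v" if "v \<bullet> x = 0" for i v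
          by (rule even_on_circle[OF x1 s \<delta>(1) _ that, of _ "G i"]) (use near in \<open>auto simp: T_def\<close>)
        then have "x \<in> T 0" using x1 ZT by (auto simp: Z_def r0)
        then show False using xT \<epsilon>(2) by blast
      qed
      ultimately show "openin (top_of_set S) U \<and> S \<subseteq> closure U" ..
    qed
    moreover have "w1 \<in> S" using w1 by (simp add: S_def)
    \<comment> \<open>A generic axis in the ball: no rational multiple of pi works for it, so its
      angle is irrational and it lies in \<open>Z\<close>, which again contradicts the choice of the
      ball.\<close>
    ultimately obtain w where w: "w \<in> \<Inter>\<G>" "dist w w1 < \<epsilon>"
      using \<epsilon>(1) by (meson closure_approachable subsetD)
    have notT: "w \<notin> T (2 * pi * q)" if "q \<in> \<rat>" for q
    proof -
      have "w \<in> S - (T (2 * pi * q) \<inter> cball w1 \<epsilon>)" using w(1) that unfolding \<G>_def by blast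
      then show ?thesis using w(2) by (simp add: dist_commute)
    qed
    have "w \<in> S" using w(1) Rats_0 unfolding \<G>_def by blast
    then obtain \<alpha> where "w \<in> T \<alpha>" using rot[of w] by (auto simp: T_def S_def)
    then have "w \<in> Z" using irr[of w \<alpha>] notT[of "\<alpha> / (2 * pi)"] by auto
    moreover have "w \<in> cball w1 \<epsilon>" using w(2) by (simp add: dist_commute)
    ultimately show False using ZT \<epsilon>(2) by blast
  qed
  show ?thesis
  proof (rule ccontr)
    assume "\<not> ?thesis"
    then obtain i v j u where iv: "F i v \<noteq> G i v" and ju: "F j u \<noteq> G j (- u)" by blast
    \<comment> \<open>The circle orthogonal to w contains the directions of both counterexamples,
      yet it must have angle 0 or pi.\<close>
    obtain w where w: "norm w = 1" "v \<bullet> w = 0" "u \<bullet> w = 0" by (rule orthogonal_unit_exists)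
    have "w \<notin> T 0" using iv w by (auto simp: T_def r0)
    moreover have "w \<notin> T pi"
    proof
      assume "w \<in> T pi"
      then have "F j (rot3 w pi (- u)) = G j (- u)" using w by (simp add: T_def)
      then show False using ju by (simp add: r0)
    qed
    ultimately show False using cover[OF w(1)] by blast
  qed
qed

subsection \<open>Fourier coefficients on the circle\<close>

lemma continuous_on_real_polynomial_function:
  fixes h :: "'a::real_normed_vector \<Rightarrow> real"
  shows "real_polynomial_function h \<Longrightarrow> continuous_on S h"
  by (simp add: continuous_on_polymonial_function real_polynomial_function_eq)

text \<open>On the circle a real linear function is a combination of \<open>cis \<phi>\<close> and
  its conjugate, so it only shifts the frequency k by one. A product is handled by absorbing one
  factor into B, which is why B stays arbitrary in the induction.\<close>

lemma integral_circle_polynomial_eq_zero: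
  fixes B :: "complex \<Rightarrow> complex" and h :: "complex \<Rightarrow> real"
  assumes "real_polynomial_function h" and B: "continuous_on UNIV B"
    and 0: "\<And>k. integral {0..2*pi} (\<lambda>\<phi>. B (cis \<phi>) * cis (of_int k * \<phi>)) = 0"
  shows "integral {0..2*pi} (\<lambda>\<phi>. B (cis \<phi>) * of_real (h (cis \<phi>)) * cis (of_int k * \<phi>)) = 0"
  using assms
proof (induction h arbitrary: B k rule: real_polynomial_function.induct)
  case (linear f)
  define a where "a = (of_real (f 1) - \<i> * of_real (f \<i>)) / 2"
  define b where "b = (of_real (f 1) + \<i> * of_real (f \<i>)) / 2"
  have int: "(\<lambda>\<phi>. c * (B (cis \<phi>) * cis (of_int k * \<phi>))) integrable_on {0..2*pi}" for c k
    by (intro integrable_continuous_real continuous_on_mult continuous_on_compose2[OF linear(2)] continuous_intros) auto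
  have "B (cis \<phi>) * of_real (f (cis \<phi>)) * cis (of_int k * \<phi>)
     = a * (B (cis \<phi>) * cis (of_int (k+1) * \<phi>)) + b * (B (cis \<phi>) * cis (of_int (k-1) * \<phi>))" for \<phi>
  proof -
    have "f (cis \<phi>) = f (cos \<phi> *\<^sub>R 1 + sin \<phi> *\<^sub>R \<i>)" by (rule arg_cong[where f = f]) (simp add: complex_eq_iff)
    then have "f (cis \<phi>) = cos \<phi> * f 1 + sin \<phi> * f \<i>"
      using linear(1) by (simp add: linear_simps)
    then have f: "of_real (f (cis \<phi>)) = a * cis \<phi> + b * cis (- \<phi>)"
      by (simp add: a_def b_def complex_eq_iff field_simps)
    have "cis (of_int (k+1) * \<phi>) = cis (of_int k * \<phi>) * cis \<phi>" "cis (of_int (k-1) * \<phi>) = cis (of_int k * \<phi>) * cis (- \<phi>)"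
      by (simp_all add: cis_mult algebra_simps)
    then show ?thesis unfolding f by (simp add: algebra_simps)
  qed
  then show ?case
    using integral_add[OF int[of a "k+1"] int[of b "k-1"]] linear(3)[of "k+1"] linear(3)[of "k-1"] by simp
next
  case (const c)
  then show ?case by (simp add: mult_ac)
next
  case (add f g)
  have int: "(\<lambda>\<phi>. B (cis \<phi>) * of_real (h (cis \<phi>)) * cis (of_int k * \<phi>)) integrable_on {0..2*pi}"
    if "real_polynomial_function h" for h
    by (intro integrable_continuous_real continuous_on_mult continuous_on_compose2[OF add.prems(1)]
         continuous_on_of_real continuous_on_compose2[OF continuous_on_real_polynomial_function[OF that, of UNIV]]
         continuous_on_cis continuous_on_id continuous_on_const) auto
  show ?case
    using add.IH[OF add.prems] integral_add[OF int[OF add.hyps(1)] int[OF add.hyps(2)]] by (simp add: algebra_simps)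
next
  case (mult f g)
  have "continuous_on UNIV f"
    using mult.hyps(1) by (rule continuous_on_real_polynomial_function)
  then have "continuous_on UNIV (\<lambda>z. B z * of_real (f z))"
    by (intro continuous_intros mult.prems(1))
  from mult.IH(2)[OF this mult.IH(1)[OF mult.prems]] show ?case by (simp add: mult.assoc)
qed

text \<open>After subtracting the mean all frequencies vanish, the negative ones by conjugation
  since A is real. The remainder B is then orthogonal to all polynomials and, approximating B itself
  by one of them, to itself.\<close>

theorem fourier_coefficients_eq_zero_imp_constant:
  fixes A :: "complex \<Rightarrow> real"
  assumes A: "continuous_on UNIV A"
    and 0: "\<And>m :: nat. m > 0 \<Longrightarrow> integral {0..2*pi} (\<lambda>\<phi>. of_real (A (cis \<phi>)) * cis (of_nat m * \<phi>)) = 0"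
    and z: "norm z = 1" "norm z' = 1"
  shows "A z = A z'"
proof -
  define \<mu> where "\<mu> = integral {0..2*pi} (\<lambda>\<phi>. A (cis \<phi>)) / (2 * pi)"
  define B where "B z = A z - \<mu>" for z
  have contB: "continuous_on UNIV B" unfolding B_def by (intro continuous_intros A)
  have contBc: "continuous_on S (\<lambda>\<phi>. B (cis \<phi>))" for S
    by (rule continuous_on_compose2[OF contB]) (intro continuous_intros, auto)
  have contAc: "continuous_on S (\<lambda>\<phi>. A (cis \<phi>))" for S
    by (rule continuous_on_compose2[OF A]) (intro continuous_intros, auto)
  have pos: "integral {0..2*pi} (\<lambda>\<phi>. of_real (B (cis \<phi>)) * cis (of_nat m * \<phi>)) = 0" for m :: nat
  proof (cases "m = 0")
    case True
    have "integral {0..2*pi} (\<lambda>\<phi>. B (cis \<phi>)) = 0"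
      unfolding B_def by (subst integral_diff) (auto intro!: integrable_continuous_real contAc simp: \<mu>_def)
    then show ?thesis using True has_integral_of_real[OF integrable_integral[OF integrable_continuous_real[OF contBc[of "{0..2*pi}"]]]]
      by (auto dest!: integral_unique)
  next
    case False
    have "((\<lambda>\<phi>. cis (m * \<phi>)) has_integral (cis (m * (2*pi)) / (\<i> * m) - cis (m * (0::real)) / (\<i> * m))) {0..2*pi}"
    proof (rule fundamental_theorem_of_calculus)
      fix x :: real
      have "((\<lambda>z. exp (\<i> * m * z) / (\<i> * m)) has_field_derivative exp (\<i> * m * of_real x)) (at (of_real x))"
        using False by (auto intro!: derivative_eq_intros)
      then have "((\<lambda>\<phi>. exp (\<i> * m * of_real \<phi>) / (\<i> * m)) has_vector_derivative exp (\<i> * m * of_real x)) (at x within {0..2*pi})"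
        by (rule has_vector_derivative_real_field)
      then show "((\<lambda>\<phi>. cis (m * \<phi>) / (\<i> * m)) has_vector_derivative cis (m * x)) (at x within {0..2*pi})"
        by (simp add: cis_conv_exp mult.assoc)
    qed simp
    also have "cis (m * (2*pi)) = 1" using Complex.DeMoivre[of "2*pi" m] by (simp only: cis_2pi power_one)
    finally have "integral {0..2*pi} (\<lambda>\<phi>. cis (m * \<phi>)) = 0" by (simp add: integral_unique)
    moreover have "integral {0..2*pi} (\<lambda>\<phi>. of_real (B (cis \<phi>)) * cis (m * \<phi>))
      = integral {0..2*pi} (\<lambda>\<phi>. of_real (A (cis \<phi>)) * cis (m * \<phi>)) - of_real \<mu> * integral {0..2*pi} (\<lambda>\<phi>. cis (m * \<phi>))"
      unfolding B_def of_real_diff left_diff_distrib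
      by (subst integral_diff) (auto intro!: integrable_continuous_real continuous_intros contAc)
    ultimately show ?thesis using 0[of m] False by simp
  qed
  have all: "integral {0..2*pi} (\<lambda>\<phi>. of_real (B (cis \<phi>)) * cis (of_int k * \<phi>)) = 0" for k :: int
  proof (cases "k \<ge> 0")
    case True
    then show ?thesis using pos[of "nat k"] by simp
  next
    case False
    have "cnj (integral {0..2*pi} (\<lambda>\<phi>. of_real (B (cis \<phi>)) * cis (of_nat (nat (- k)) * \<phi>))) = 0"
      unfolding pos by simp
    then show ?thesis using False by (simp add: integral_cnj cis_cnj)
  qed
  have orth: "integral {0..2*pi} (\<lambda>\<phi>. B (cis \<phi>) * p (cis \<phi>)) = 0" if p: "real_polynomial_function p" for p
  proof -
    have cp: "continuous_on UNIV p"
      using p(1) by (rule continuous_on_real_polynomial_function)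
    have "(\<lambda>\<phi>. B (cis \<phi>) * p (cis \<phi>)) integrable_on {0..2*pi}"
      by (intro integrable_continuous_real continuous_on_mult contBc continuous_on_compose2[OF cp] continuous_intros) auto
    from integral_unique[OF has_integral_of_real[OF integrable_integral[OF this], where 'b = complex]]
    have "of_real (integral {0..2*pi} (\<lambda>\<phi>. B (cis \<phi>) * p (cis \<phi>))) = integral {0..2*pi} (\<lambda>\<phi>. of_real (B (cis \<phi>)) * of_real (p (cis \<phi>)) :: complex)"
      by simp
    also have "\<dots> = 0"
      using integral_circle_polynomial_eq_zero[OF p _ all, of 0] contB by (simp add: continuous_on_of_real)
    finally show ?thesis by simp
  qed
  define I where "I = integral {0..2*pi} (\<lambda>\<phi>. (B (cis \<phi>))\<^sup>2)"
  obtain C where C: "\<And>\<phi>. \<bar>B (cis \<phi>)\<bar> \<le> C"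
  proof -
    have "compact (B ` sphere 0 1)"
      by (intro compact_continuous_image continuous_on_subset[OF contB]) auto
    then obtain C where "\<And>x. x \<in> sphere 0 1 \<Longrightarrow> norm (B x) \<le> C"
      using compact_imp_bounded bounded_iff by (metis imageI)
    then show thesis using that[of C] by simp
  qed
  have C0: "C \<ge> 0" using C[of 0] abs_ge_zero order_trans by blast
  have "\<bar>I\<bar> \<le> 0"
  proof (rule field_le_epsilon)
    fix e :: real assume e: "e > 0"
    \<comment> \<open>Chosen so that the final bound is e; the summand 1 keeps the denominator
      positive when C = 0.\<close>
    define d where "d = e / (C * (2 * pi) + 1)"
    have d: "d > 0" using e C0 by (simp add: d_def add_nonneg_pos)
    obtain p where p: "real_polynomial_function p" "\<And>z. z \<in> sphere 0 1 \<Longrightarrow> \<bar>B z - p z\<bar> < d"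
      using Stone_Weierstrass_real_polynomial_function[of "sphere 0 1" B d] d contB continuous_on_subset
      by (metis compact_sphere subset_UNIV)
    have cp: "continuous_on UNIV p"
      using p(1) by (rule continuous_on_real_polynomial_function)
    have cpc: "continuous_on S (\<lambda>\<phi>. p (cis \<phi>))" for S
      by (rule continuous_on_compose2[OF cp]) (intro continuous_intros, auto)
    have "I = integral {0..2*pi} (\<lambda>\<phi>. (B (cis \<phi>))\<^sup>2) - integral {0..2*pi} (\<lambda>\<phi>. B (cis \<phi>) * p (cis \<phi>))"
      unfolding I_def orth[OF p(1)] by simp
    also have "\<dots> = integral {0..2*pi} (\<lambda>\<phi>. (B (cis \<phi>))\<^sup>2 - B (cis \<phi>) * p (cis \<phi>))"
      by (intro integral_diff[symmetric] integrable_continuous_real continuous_intros contBc cpc)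
    also have "norm \<dots> \<le> (C * d) * (2 * pi - 0)"
    proof (rule integral_bound)
      fix t
      have "\<bar>(B (cis t))\<^sup>2 - B (cis t) * p (cis t)\<bar> = \<bar>B (cis t)\<bar> * \<bar>B (cis t) - p (cis t)\<bar>"
        by (simp flip: abs_mult add: power2_eq_square right_diff_distrib)
      also have "\<dots> \<le> C * d"
        using C[of t] p(2)[of "cis t"] C0 by (intro mult_mono) auto
      finally show "norm ((B (cis t))\<^sup>2 - B (cis t) * p (cis t)) \<le> C * d" by simp
    qed (intro continuous_intros contBc cpc | simp)+
    also have "\<dots> \<le> (C * (2 * pi) + 1) * d" using d by (simp add: algebra_simps)
    also have "\<dots> = e" using C0 pi_gt_zero by (simp add: d_def add_nonneg_eq_0_iff)
    finally show "\<bar>I\<bar> \<le> 0 + e" by simp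
  qed
  then have I0: "I = 0" by simp
  have B0: "B (cis \<phi>) = 0" if "\<phi> \<in> {0..2*pi}" for \<phi>
    using integral_eq_0_iff[of 0 "2*pi" "\<lambda>\<phi>. (B (cis \<phi>))\<^sup>2", OF continuous_on_power[OF contBc]] I0 that
    by (simp add: I_def)
  have "B w = 0" if w: "norm w = 1" for w
    using B0[of "Arg2pi w"] w Arg2pi_ge_0[of w] Arg2pi_lt_2pi[of w] Arg2pi_eq[of w] by (simp add: cis_conv_exp)
  then show ?thesis using z by (simp add: B_def)
qed

subsection \<open>Reflections of great circles\<close>

text \<open>The Hopf parametrisation of oriented orthonormal frames: a point \<open>p\<close> of \<open>S\<^sup>3\<close> chooses a
  parametrised great circle, and replacing \<open>p\<close> by \<open>c p\<close> with \<open>|c| = 1\<close> turns its starting point by \<open>c\<^sup>-\<^sup>2\<close>.\<close>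

definition spin_frame :: "complex \<times> complex \<Rightarrow> complex \<Rightarrow> real ^ 3" where
  "spin_frame p z = vector [Re (cnj z * ((fst p)\<^sup>2 - (snd p)\<^sup>2)),
     Re (cnj z * (\<i> * ((fst p)\<^sup>2 + (snd p)\<^sup>2))), Re (cnj z * (2 * fst p * snd p))]"

text \<open>For general p the inner product carries the factor \<open>norm p ^ 4\<close>, so unit p
  give isometric embeddings of the complex plane.\<close>

lemma inner_spin_frame:
  assumes "norm p = 1"
  shows "spin_frame p z \<bullet> spin_frame p z' = Re (z * cnj z')"
proof -
  obtain a b c d where p: "p = (Complex a b, Complex c d)" by (metis complex.exhaust surj_pair)
  have 1: "a\<^sup>2 + b\<^sup>2 + (c\<^sup>2 + d\<^sup>2) = 1"
    using assms by (simp add: p norm_Pair cmod_def)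
  have "spin_frame p z \<bullet> spin_frame p z' = (a\<^sup>2 + b\<^sup>2 + (c\<^sup>2 + d\<^sup>2))\<^sup>2 * Re (z * cnj z')"
    by (simp add: spin_frame_def p inner_vec_def sum_3 power2_eq_square algebra_simps)
  then show ?thesis unfolding 1 by simp
qed

lemma spin_frame_add: "spin_frame p (z + z') = spin_frame p z + spin_frame p z'"
  by (simp add: spin_frame_def vec_eq_iff forall_3 algebra_simps)

lemma spin_frame_scaleR: "spin_frame p (r *\<^sub>R z) = r *\<^sub>R spin_frame p z"
  by (simp add: spin_frame_def vec_eq_iff forall_3 algebra_simps)

lemma spin_frame_diff: "spin_frame p (z - z') = spin_frame p z - spin_frame p z'"
  by (simp add: spin_frame_def vec_eq_iff forall_3 algebra_simps)

lemma spin_frame_mult: "spin_frame (c * fst p, c * snd p) z = spin_frame p (cnj (c\<^sup>2) * z)"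
  by (simp add: spin_frame_def power2_eq_square algebra_simps)

lemma continuous_spin_frame:
  fixes p :: "'a::t2_space \<Rightarrow> complex \<times> complex"
  assumes "continuous_on S p" "continuous_on S z"
  shows "continuous_on S (\<lambda>x. spin_frame (p x) (z x))"
proof -
  have "spin_frame (p x) (z x) = Re (cnj (z x) * ((fst (p x))\<^sup>2 - (snd (p x))\<^sup>2)) *\<^sub>R axis 1 1
     + Re (cnj (z x) * (\<i> * ((fst (p x))\<^sup>2 + (snd (p x))\<^sup>2))) *\<^sub>R axis 2 1 
     + Re (cnj (z x) * (2 * fst (p x) * snd (p x))) *\<^sub>R axis 3 1" for x
    by (simp add: spin_frame_def vec_eq_iff forall_3 axis_def)
  then show ?thesis using assms by (simp only:) (intro continuous_intros)
qed

lemma orthogonal_plane_eq: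
  assumes "norm w = 1" "norm e = 1" "e \<bullet> w = 0" "v \<bullet> w = 0"
  shows "v = (v \<bullet> e) *\<^sub>R e + (v \<bullet> cross3 w e) *\<^sub>R cross3 w e"
proof -
  have [simp]: "w \<bullet> w = 1" "e \<bullet> e = 1" "w \<bullet> e = 0" using assms by (simp_all add: norm_eq_1 inner_commute)
  define y where "y = v - (v \<bullet> e) *\<^sub>R e"
  have y: "y \<bullet> e = 0" "y \<bullet> w = 0" using assms by (simp_all add: y_def inner_diff_left)
  have "norm (cross3 w e) = 1" using norm_cross3_orthogonal[OF assms(3)] assms by simp
  then have ce: "cross3 w e \<bullet> cross3 w e = 1" by (simp add: norm_eq_1)
  have "cross3 (cross3 w e) (cross3 y (cross3 w e)) = y - (y \<bullet> cross3 w e) *\<^sub>R cross3 w e"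
    by (subst cross3_cross3_right) (simp add: ce inner_commute)
  \<comment> \<open>Orthogonal to both w and e, the vector y is parallel to their cross
    product.\<close>
  moreover have "cross3 y (cross3 w e) = 0" using y by (simp add: cross3_cross3_right)
  ultimately have "y = (y \<bullet> cross3 w e) *\<^sub>R cross3 w e" by simp
  also have "y \<bullet> cross3 w e = v \<bullet> cross3 w e" by (simp add: y_def inner_diff_left dot_cross_self)
  finally have "(v \<bullet> e) *\<^sub>R e + y = (v \<bullet> e) *\<^sub>R e + (v \<bullet> cross3 w e) *\<^sub>R cross3 w e" by (rule arg_cong)
  then show ?thesis by (simp add: y_def)
qed

text \<open>Simple connectedness of the three-sphere gives a continuous logarithm of \<sigma>. Along
  the Hopf fibre through (1, 0), this logarithm minus i N \<tau> is always a logarithm of the one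
  number \<open>\<sigma> (1, 0)\<close>, hence constant; going once around forces N = 0.\<close>

theorem no_equivariant_function_on_S3:
  fixes \<sigma> :: "complex \<times> complex \<Rightarrow> complex"
  assumes cont: "continuous_on (sphere 0 1) \<sigma>" and nz: "\<And>p. norm p = 1 \<Longrightarrow> \<sigma> p \<noteq> 0"
    and equi: "\<And>c p. norm c = 1 \<Longrightarrow> norm p = 1 \<Longrightarrow> \<sigma> (c * fst p, c * snd p) = c ^ N * \<sigma> p"
  shows "N = 0"
proof -
  have "simply_connected (sphere (0 :: complex \<times> complex) 1)"
    by (rule simply_connected_sphere) simp
  then obtain g where g: "continuous_on (sphere 0 1) g" "\<And>p. p \<in> sphere 0 1 \<Longrightarrow> \<sigma> p = exp (g p)"
    using continuous_logarithm_on_simply_connected[OF cont _ locally_path_connected_sphere] nz by auto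
  define k where "k \<tau> = g (cis \<tau>, 0) - \<i> * of_real (real N * \<tau>)" for \<tau>
  have contk: "continuous_on UNIV k"
    unfolding k_def
    by (intro continuous_on_diff continuous_on_compose2[OF g(1)] continuous_intros) (auto simp: norm_Pair)
  have exk: "exp (k \<tau>) = \<sigma> (1, 0)" for \<tau>
  proof -
    have "exp (g (cis \<tau>, 0)) = cis \<tau> ^ N * \<sigma> (1, 0)"
      using g(2)[of "(cis \<tau>, 0)"] equi[of "cis \<tau>" "(1, 0)"] by (simp add: norm_Pair)
    then show ?thesis
      by (simp add: k_def exp_diff cis_conv_exp flip: exp_of_nat_mult) (simp add: mult_ac)
  qed
  have "k constant_on UNIV"
  proof (rule continuous_discrete_range_constant)
    show "connected (UNIV :: real set)" by simp
    show "continuous_on UNIV k" by (rule contk)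
    fix x
    \<comment> \<open>Distinct logarithms of the same number are at least 2 pi apart, so the range
      of k is discrete.\<close>
    have "2 * pi \<le> norm (k y - k x)" if "k y \<noteq> k x" for y
    proof (rule ccontr)
      assume "\<not> ?thesis"
      then have "\<bar>Im (k y) - Im (k x)\<bar> < 2 * pi"
        using abs_Im_le_cmod[of "k y - k x"] by simp
      then show False using exp_complex_eqI[of "k y" "k x"] exk that by simp
    qed
    then show "\<exists>e>0. \<forall>y. y \<in> UNIV \<and> k y \<noteq> k x \<longrightarrow> e \<le> norm (k y - k x)"
      by (intro exI[of _ "2 * pi"]) auto
  qed
  then have "k 0 = k (2 * pi)" unfolding constant_on_def by auto
  then show ?thesis by (simp add: k_def)
qed


definition fourier_coefficient :: "(real ^ 3 \<Rightarrow> real) \<Rightarrow> nat \<Rightarrow> complex \<times> complex \<Rightarrow> complex" where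
  "fourier_coefficient H m p = integral {0..2*pi} (\<lambda>\<phi>. of_real (H (spin_frame p (cis \<phi>))) * cis \<phi> ^ m)"

lemma continuous_fourier_coefficient:
  assumes "continuous_on UNIV H"
  shows "continuous_on S (fourier_coefficient H m)"
  unfolding fourier_coefficient_def
  by (rule continuous_on_circle_mean)
    (auto simp: case_prod_unfold intro!: continuous_intros continuous_on_compose2[OF assms] continuous_spin_frame)

lemma continuous_spin_frame_power:
  assumes "continuous_on UNIV H"
  shows "continuous_on UNIV (\<lambda>z. of_real (H (spin_frame p z)) * (a * z) ^ m :: complex)"
  by (auto intro!: continuous_intros continuous_on_compose2[OF assms] continuous_spin_frame)

text \<open>Moving p along its Hopf fibre shifts the parameter of the circle by the inverse square
  of c, and the substitution hands this shift to the character. Thus the m-th coefficient has weight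
  2 m along the fibres.\<close>

lemma fourier_coefficient_mult:
  assumes H: "continuous_on UNIV H" and c: "norm c = 1"
  shows "fourier_coefficient H m (c * fst p, c * snd p) = c ^ (2 * m) * fourier_coefficient H m p"
proof -
  have "c\<^sup>2 * cnj (c\<^sup>2) = 1" using complex_norm_square[of "c\<^sup>2"] c by (simp only: norm_power power_one of_real_1)
  then have cc: "c\<^sup>2 * (cnj (c\<^sup>2) * z) = z" for z by (simp flip: mult.assoc)
  have cm: "(c\<^sup>2 * z) ^ m = c ^ (2 * m) * z ^ m" for z by (simp only: power_mult_distrib power_mult)
  let ?A = "\<lambda>z. of_real (H (spin_frame p z)) * (c\<^sup>2 * z) ^ m"
  have "fourier_coefficient H m (c * fst p, c * snd p) = integral {0..2*pi} (\<lambda>\<phi>. ?A (cnj (c\<^sup>2) * cis \<phi>))"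
    unfolding fourier_coefficient_def spin_frame_mult cc ..
  also have "\<dots> = integral {0..2*pi} (\<lambda>\<phi>. ?A (cis \<phi>))"
    by (rule integral_circle_rotate[OF continuous_spin_frame_power[OF H]]) (simp add: norm_power c)
  also have "\<dots> = integral {0..2*pi} (\<lambda>\<phi>. c ^ (2 * m) * (of_real (H (spin_frame p (cis \<phi>))) * cis \<phi> ^ m))"
    by (simp only: cm mult.left_commute)
  finally show ?thesis by (simp only: fourier_coefficient_def integral_mult_right)
qed

text \<open>Reversing the circle conjugates the coefficient because F is real, and the shift by a
  contributes the phase.\<close>

lemma fourier_coefficient_reflect:
  assumes F: "continuous_on UNIV F" and a: "norm a = 1"
    and FG: "\<And>z. G (spin_frame p z) = F (spin_frame p (a * cnj z))"
  shows "fourier_coefficient G m p = a ^ m * cnj (fourier_coefficient F m p)"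
proof -
  let ?A = "\<lambda>z. of_real (F (spin_frame p z)) * cnj (cnj a * z) ^ m"
  have aa: "cnj (cnj a * (a * cnj z)) = z" for z
  proof -
    have "cnj (cnj a * (a * cnj z)) = (a * cnj a) * z" by simp
    also have "a * cnj a = 1" using a by (simp flip: complex_norm_square)
    finally show ?thesis by simp
  qed
  have A: "continuous_on UNIV ?A"
    by (auto intro!: continuous_intros continuous_on_compose2[OF F] continuous_spin_frame)
  have "fourier_coefficient G m p = integral {0..2*pi} (\<lambda>\<phi>. ?A (a * cnj (cis \<phi>)))"
    unfolding fourier_coefficient_def FG aa ..
  also have "\<dots> = integral {0..2*pi} (\<lambda>\<phi>. ?A (a * cis \<phi>))"
    by (rule integral_circle_cnj[of "\<lambda>z. ?A (a * z)"])
  also have "\<dots> = integral {0..2*pi} (\<lambda>\<phi>. ?A (cis \<phi>))"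
    by (rule integral_circle_rotate[OF A a])
  also have "\<dots> = integral {0..2*pi} (\<lambda>\<phi>. a ^ m * cnj (of_real (F (spin_frame p (cis \<phi>))) * cis \<phi> ^ m))"
    by (simp add: power_mult_distrib mult_ac)
  finally show ?thesis by (simp add: fourier_coefficient_def integral_cnj)
qed

text \<open>A single circle has to serve all indices i. Hence coefficients of different members and
  different degrees are merged into one function on the three-sphere.\<close>

theorem great_circle_reflections:
  fixes F G :: "'i \<Rightarrow> real ^ 3 \<Rightarrow> real"
  assumes F: "\<And>i. continuous_on UNIV (F i)" and G: "\<And>i. continuous_on UNIV (G i)"
    and mirror: "\<And>w. norm w = 1 \<Longrightarrow> \<exists>u. norm u = 1 \<and> u \<bullet> w = 0 \<and>
        (\<forall>v. v \<bullet> w = 0 \<longrightarrow> (\<forall>i. F i ((2 * (v \<bullet> u)) *\<^sub>R u - v) = G i v))"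
  shows "\<exists>w. norm w = 1 \<and> (\<forall>v i. norm v = 1 \<longrightarrow> v \<bullet> w = 0 \<longrightarrow> F i (- v) = F i v)"
proof (rule ccontr)
  assume neg: "\<not> ?thesis"
  let ?c = fourier_coefficient
  define w where "w p = cross3 (spin_frame p 1) (spin_frame p \<i>)" for p
  have frame: "norm (spin_frame p z) = norm z" if "norm p = 1" for p z
    using inner_spin_frame[OF that, of z z] by (simp add: norm_eq_sqrt_inner flip: complex_norm_square)
  have w: "norm (w p) = 1" if "norm p = 1" for p
    using norm_cross3_orthogonal[of "spin_frame p \<i>" "spin_frame p 1"] frame[OF that] inner_spin_frame[OF that]
    by (simp add: w_def)
  have perp: "spin_frame p z \<bullet> w p = 0" for p z
  proof -
    have "spin_frame p z = spin_frame p (Re z *\<^sub>R 1 + Im z *\<^sub>R \<i>)"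
      by (rule arg_cong[where f = "spin_frame p"]) (simp add: complex_eq_iff)
    then show ?thesis
      by (simp only: spin_frame_add spin_frame_scaleR w_def inner_add_left inner_scaleR_left dot_cross_self
          mult_zero_right add_0)
  qed
  have span: "\<exists>z. norm z = 1 \<and> v = spin_frame p z" if p: "norm p = 1" and v: "norm v = 1" "v \<bullet> w p = 0" for p v
  proof -
    let ?e = "spin_frame p 1"
    have e: "norm ?e = 1" "?e \<bullet> w p = 0" using frame[OF p] perp by simp_all
    have "?e \<bullet> ?e = 1" "?e \<bullet> spin_frame p \<i> = 0" using inner_spin_frame[OF p] by simp_all
    then have we: "cross3 (w p) ?e = spin_frame p \<i>"
      by (simp add: w_def cross3_cross3_left inner_commute)
    have "v = spin_frame p (Complex (v \<bullet> ?e) (v \<bullet> spin_frame p \<i>))"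
    proof -
      have "v = (v \<bullet> ?e) *\<^sub>R ?e + (v \<bullet> spin_frame p \<i>) *\<^sub>R spin_frame p \<i>"
        using orthogonal_plane_eq[OF w[OF p] e v(2)] unfolding we .
      also have "\<dots> = spin_frame p ((v \<bullet> ?e) *\<^sub>R 1 + (v \<bullet> spin_frame p \<i>) *\<^sub>R \<i>)"
        by (simp only: spin_frame_add spin_frame_scaleR)
      also have "(v \<bullet> ?e) *\<^sub>R 1 + (v \<bullet> spin_frame p \<i>) *\<^sub>R \<i> = Complex (v \<bullet> ?e) (v \<bullet> spin_frame p \<i>)"
        by (simp add: complex_eq_iff)
      finally show ?thesis .
    qed
    then show ?thesis using frame[OF p] v(1) by metis
  qed
  \<comment> \<open>If no circle is symmetric, some coefficient of positive degree is nonzero at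
    every p, so these open sets cover the compact sphere and finitely many suffice.\<close>
  define U where "U = (\<lambda>(i, m). {p. ?c (F i) m p \<noteq> 0})"
  have "sphere 0 1 \<subseteq> (\<Union>x \<in> UNIV \<times> {0<..}. U x)"
  proof
    fix p :: "complex \<times> complex" assume "p \<in> sphere 0 1"
    then have p: "norm p = 1" by simp
    obtain v i where v: "norm v = 1" "v \<bullet> w p = 0" and ne: "F i (- v) \<noteq> F i v"
      using neg w[OF p] by blast
    obtain z where z: "norm z = 1" "v = spin_frame p z" using span[OF p v] by blast
    have mv: "- v = spin_frame p (- z)" using spin_frame_scaleR[of p "-1" z] z by simp
    have "continuous_on UNIV (\<lambda>z. F i (spin_frame p z))"
      by (auto intro!: continuous_intros continuous_on_compose2[OF F] continuous_spin_frame)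
    then have "\<exists>m>0. ?c (F i) m p \<noteq> 0"
      using fourier_coefficients_eq_zero_imp_constant[of "\<lambda>z. F i (spin_frame p z)" z "- z"] ne z mv
      by (auto simp: fourier_coefficient_def Complex.DeMoivre)
    then show "p \<in> (\<Union>x \<in> UNIV \<times> {0<..}. U x)" by (auto simp: U_def)
  qed
  moreover have "open (U x)" for x
    unfolding U_def
    by (cases x) (simp add: open_Collect_neq continuous_fourier_coefficient F)
  ultimately obtain I where I: "I \<subseteq> UNIV \<times> {0<..}" "finite I" and cover: "sphere 0 1 \<subseteq> (\<Union>x \<in> I. U x)"
    using compactE_image[OF compact_sphere, of "UNIV \<times> {0<..}" U] by metis
  \<comment> \<open>A common multiple of the degrees in the finite cover; raising the product of
    degree m to the power \<open>M div m\<close> brings all summands to the same weight and the same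
    phase.\<close>
  define M where "M = (\<Prod>x\<in>I. snd x)"
  have M: "M > 0" using I by (auto simp: M_def intro!: prod_pos)
  have dvd: "m * (M div m) = M" if "(i, m) \<in> I" for i m
    using dvd_prodI[OF I(2) that, of snd] by (simp add: M_def)
  \<comment> \<open>Only F and G enter here, so \<sigma> is continuous even though the axis u need
    not be chosen continuously in the circle.\<close>
  define \<sigma> where "\<sigma> p = (\<Sum>(i, m)\<in>I. (?c (F i) m p * ?c (G i) m p) ^ (M div m))" for p
  have "continuous_on (sphere 0 1) \<sigma>"
    unfolding \<sigma>_def case_prod_unfold by (intro continuous_intros continuous_fourier_coefficient F G)
  moreover have "\<sigma> p \<noteq> 0" if p: "norm p = 1" for p
  proof -
    obtain u where u: "norm u = 1" "u \<bullet> w p = 0"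
      and FG: "\<And>v i. v \<bullet> w p = 0 \<Longrightarrow> F i ((2 * (v \<bullet> u)) *\<^sub>R u - v) = G i v"
      using mirror[OF w[OF p]] by blast
    obtain a where a: "norm a = 1" "u = spin_frame p a" using span[OF p u] by blast
    \<comment> \<open>In the complex coordinate, the reflection fixing a is z mapped to a^2 times
      the conjugate of z. All summands of \<sigma> thereby get the common phase
      \<open>(a\<^sup>2) ^ M\<close> times a nonnegative number, and cannot cancel.\<close>
    have "G i (spin_frame p z) = F i (spin_frame p (a\<^sup>2 * cnj z))" for i z
    proof -
      have "(2 * Re (z * cnj a)) *\<^sub>R a - z = (z * cnj a + cnj (z * cnj a)) * a - z"
        by (simp only: complex_add_cnj) (simp add: scaleR_conv_of_real)
      also have "\<dots> = (a * cnj a) * z + a\<^sup>2 * cnj z - z" by (simp add: power2_eq_square algebra_simps)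
      also have "a * cnj a = 1" using a by (simp flip: complex_norm_square)
      finally have "(2 * Re (z * cnj a)) *\<^sub>R a - z = a\<^sup>2 * cnj z" by simp
      then have "spin_frame p (a\<^sup>2 * cnj z) = (2 * (spin_frame p z \<bullet> u)) *\<^sub>R u - spin_frame p z"
        unfolding a(2) inner_spin_frame[OF p] by (metis spin_frame_diff spin_frame_scaleR)
      then show ?thesis using FG[OF perp] by simp
    qed
    then have "?c (G i) m p = (a\<^sup>2) ^ m * cnj (?c (F i) m p)" for i m
      using a(1) by (intro fourier_coefficient_reflect[OF F]) (auto simp: norm_power)
    then have prod: "?c (F i) m p * ?c (G i) m p = (a\<^sup>2) ^ m * of_real ((norm (?c (F i) m p))\<^sup>2)" for i m
      by (simp add: complex_norm_square mult_ac flip: of_real_power)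
    define S where "S = (\<Sum>(i, m)\<in>I. ((norm (?c (F i) m p))\<^sup>2) ^ (M div m))"
    have key: "(?c (F i) m p * ?c (G i) m p) ^ (M div m)
        = (a\<^sup>2) ^ M * of_real (((norm (?c (F i) m p))\<^sup>2) ^ (M div m))" if im: "(i, m) \<in> I" for i m
    proof -
      have "(?c (F i) m p * ?c (G i) m p) ^ (M div m)
          = (a\<^sup>2) ^ (m * (M div m)) * of_real (((norm (?c (F i) m p))\<^sup>2) ^ (M div m))"
        unfolding prod by (simp only: power_mult_distrib power_mult of_real_power)
      then show ?thesis unfolding dvd[OF im] .
    qed
    have "\<sigma> p = (\<Sum>x\<in>I. case x of (i, m) \<Rightarrow> (a\<^sup>2) ^ M * of_real (((norm (?c (F i) m p))\<^sup>2) ^ (M div m)))"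
      unfolding \<sigma>_def
    proof (rule sum.cong[OF refl])
      fix x assume "x \<in> I"
      then show "(case x of (i, m) \<Rightarrow> (?c (F i) m p * ?c (G i) m p) ^ (M div m))
          = (case x of (i, m) \<Rightarrow> (a\<^sup>2) ^ M * of_real (((norm (?c (F i) m p))\<^sup>2) ^ (M div m)))"
        by (cases x) (simp only: prod.case key)
    qed
    also have "\<dots> = (a\<^sup>2) ^ M * of_real S"
      by (simp add: S_def sum_distrib_left case_prod_unfold)
    finally have \<sigma>: "\<sigma> p = (a\<^sup>2) ^ M * of_real S" .
    obtain i m where im: "(i, m) \<in> I" "?c (F i) m p \<noteq> 0" using cover p by (auto simp: U_def)
    have "S > 0"
      unfolding S_def using I(2) im by (intro sum_pos2[where i = "(i, m)"]) auto
    moreover have "a \<noteq> 0" using a(1) by auto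
    ultimately show ?thesis using \<sigma> by simp
  qed
  \<comment> \<open>Each product has weight 2 m + 2 m, and the power \<open>M div m\<close> raises
    this to 4 M for every summand.\<close>
  moreover have "\<sigma> (c * fst p, c * snd p) = c ^ (4 * M) * \<sigma> p" if c: "norm c = 1" for c p
  proof -
    have "(c ^ (2 * m) * x * (c ^ (2 * m) * y)) ^ (M div m) = c ^ (4 * M) * (x * y) ^ (M div m)"
      if "(i, m) \<in> I" for x y i m
    proof -
      have "c ^ (2 * m) * c ^ (2 * m) = c ^ (4 * m)" by (simp flip: power_add)
      then have "c ^ (2 * m) * x * (c ^ (2 * m) * y) = c ^ (4 * m) * (x * y)"
        by (metis mult.assoc mult.left_commute)
      then have "(c ^ (2 * m) * x * (c ^ (2 * m) * y)) ^ (M div m) = c ^ (4 * m * (M div m)) * (x * y) ^ (M div m)"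
        by (simp only: power_mult_distrib power_mult)
      then show ?thesis using dvd[OF that] by (simp add: mult.assoc)
    qed
    then show ?thesis
      unfolding \<sigma>_def sum_distrib_left fourier_coefficient_mult[OF F c] fourier_coefficient_mult[OF G c]
      by (intro sum.cong) auto
  qed
  ultimately have "4 * M = 0" by (rule no_equivariant_function_on_S3)
  then show False using M by simp
qed

subsection \<open>Passage to the three-sphere\<close>

text \<open>Degree one makes the extension continuous at 0 with value 0, so each slice at a fixed
  height t is a continuous function on the whole of three-space.\<close>

definition hom_extension :: "('a::euclidean_space \<Rightarrow> real) \<Rightarrow> 'a \<Rightarrow> real" where
  "hom_extension f y = norm y * f (sgn y)"

lemma hom_extension_unit: "norm y = 1 \<Longrightarrow> hom_extension f y = f y"
  by (simp add: hom_extension_def sgn_div_norm)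

lemma continuous_hom_extension:
  fixes f :: "'a::euclidean_space \<Rightarrow> real"
  assumes f: "continuous_on (sphere 0 1) f"
  shows "continuous_on UNIV (hom_extension f)"
proof (rule continuous_at_imp_continuous_on, rule ballI)
  fix y :: 'a
  show "isCont (hom_extension f) y"
  proof (cases "y = 0")
    case False
    have "continuous_on (- {0}) (hom_extension f)"
      unfolding hom_extension_def
      by (intro continuous_on_mult continuous_on_norm continuous_on_compose2[OF f] continuous_on_sgn continuous_on_id)
        (auto simp: norm_sgn split: if_splits)
    then show ?thesis using False by (simp add: continuous_on_eq_continuous_at open_delete open_Compl)
  next
    case True
    have "compact (f ` sphere 0 1)" by (intro compact_continuous_image f) simp
    then obtain C where C: "\<And>x. x \<in> sphere 0 1 \<Longrightarrow> norm (f x) \<le> C"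
      using compact_imp_bounded bounded_iff by (metis imageI)
    have "(hom_extension f \<longlongrightarrow> 0) (at 0)"
    proof (rule Lim_null_comparison)
      have "norm (hom_extension f x) \<le> norm x * C" if "x \<noteq> 0" for x
        using C[of "sgn x"] that by (auto simp: hom_extension_def norm_sgn abs_mult intro!: mult_left_mono)
      then show "\<forall>\<^sub>F x in at 0. norm (hom_extension f x) \<le> norm x * C"
        by (simp add: eventually_at_filter)
      show "((\<lambda>x::'a. norm x * C) \<longlongrightarrow> 0) (at 0)"
        by (intro tendsto_eq_intros refl) auto
    qed
    then show ?thesis using True by (simp add: isCont_def hom_extension_def)
  qed
qed

lemma hom_extension_orthogonal_transformation:
  assumes o: "orthogonal_transformation \<phi>" and fg: "\<And>\<theta>. \<theta> \<in> S2 w \<Longrightarrow> f (\<phi> \<theta>) = g \<theta>" and x: "x \<bullet> w = 0"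
  shows "hom_extension f (\<phi> x) = hom_extension g x"
proof (cases "x = 0")
  case True
  then show ?thesis using o by (simp add: orthogonal_transformation_linear linear_0 hom_extension_def)
next
  case False
  have "sgn (\<phi> x) = \<phi> (sgn x)"
    using o by (simp add: sgn_div_norm orthogonal_transformation_norm orthogonal_transformation_linear linear_scale)
  moreover have "sgn x \<in> S2 w" using False x by (simp add: S2_def norm_sgn sgn_div_norm)
  ultimately show ?thesis using fg o by (simp add: hom_extension_def orthogonal_transformation_norm)
qed

text \<open>An isometry of three-space onto the hyperplane orthogonal to the pole, which makes the
  cross product available there.\<close>

locale hyperplane_chart =
  fixes \<zeta> :: "real ^ 4" and L :: "real ^ 3 \<Rightarrow> real ^ 4"
  assumes norm_pole: "norm \<zeta> = 1" and linear_L: "linear L"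
    and inner_L [simp]: "L x \<bullet> L y = x \<bullet> y" and L_pole [simp]: "L x \<bullet> \<zeta> = 0"
    and L_surj: "z \<bullet> \<zeta> = 0 \<Longrightarrow> \<exists>v. z = L v"

lemma hyperplane_chart_exists:
  assumes "norm (\<zeta> :: real ^ 4) = 1"
  obtains L where "hyperplane_chart \<zeta> L"
proof -
  have "\<zeta> \<noteq> 0" using assms by auto
  then have d: "dim (UNIV :: (real ^ 3) set) = dim {x. \<zeta> \<bullet> x = 0}" by (simp add: dim_hyperplane)
  have "\<exists>L :: real ^ 3 \<Rightarrow> real ^ 4. linear L \<and> L ` UNIV = {x. \<zeta> \<bullet> x = 0} \<and> (\<forall>x. norm (L x) = norm x)"
  proof (rule isometry_subspaces[OF subspace_UNIV subspace_hyperplane d])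
    fix L :: "real ^ 3 \<Rightarrow> real ^ 4"
    assume "linear L" "L ` UNIV = {x. \<zeta> \<bullet> x = 0}" "\<And>x. x \<in> UNIV \<Longrightarrow> norm (L x) = norm x"
    then show ?thesis by (intro exI[of _ L]) simp
  qed
  then obtain L :: "real ^ 3 \<Rightarrow> real ^ 4"
    where "linear L \<and> L ` UNIV = {x. \<zeta> \<bullet> x = 0} \<and> (\<forall>x. norm (L x) = norm x)" ..
  then have L: "linear L" "L ` UNIV = {x. \<zeta> \<bullet> x = 0}" and norm_L: "\<And>x. norm (L x) = norm x"
    by simp_all
  have "L x \<bullet> L y = x \<bullet> y" for x y
    using norm_L[of "x + y"] norm_L[of x] norm_L[of y] by (simp add: dot_norm linear_add[OF L(1)])
  moreover have "L x \<bullet> \<zeta> = 0" for x using L(2) by (auto simp: inner_commute)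
  moreover have "\<exists>x. y = L x" if "y \<bullet> \<zeta> = 0" for y
  proof -
    have "y \<in> L ` UNIV" using that by (simp add: L(2) inner_commute)
    then show ?thesis by blast
  qed
  ultimately have "hyperplane_chart \<zeta> L" using assms L(1) by (simp add: hyperplane_chart_def)
  then show thesis by (rule that)
qed

context hyperplane_chart
begin

lemma pole_pole [simp]: "\<zeta> \<bullet> \<zeta> = 1"
  using norm_pole by (simp add: norm_eq_1)

lemma pole_L [simp]: "\<zeta> \<bullet> L x = 0"
  using L_pole[of x] by (simp only: inner_commute)

lemma norm_L [simp]: "norm (L x) = norm x"
  by (simp add: norm_eq_sqrt_inner)

lemmas L_simps = linear_add[OF linear_L] linear_diff[OF linear_L] linear_scale[OF linear_L] linear_neg[OF linear_L]

lemma L_eq_iff: "L x = L y \<longleftrightarrow> x = y"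
proof
  assume "L x = L y"
  then have "norm (L (x - y)) = 0" by (simp add: L_simps)
  then show "x = y" by simp
qed simp

lemma decompose:
  obtains t v where "x = t *\<^sub>R \<zeta> + L v"
proof -
  have "(x - (x \<bullet> \<zeta>) *\<^sub>R \<zeta>) \<bullet> \<zeta> = 0" by (simp add: inner_diff_left)
  then obtain v where "x - (x \<bullet> \<zeta>) *\<^sub>R \<zeta> = L v" using L_surj by blast
  then have "x = (x \<bullet> \<zeta>) *\<^sub>R \<zeta> + L v" by (simp add: algebra_simps)
  then show thesis by (rule that)
qed

lemma L_in_S2_pole: "norm w = 1 \<Longrightarrow> L w \<in> S2 \<zeta>"
  by (simp add: S2_def)

text \<open>With \<zeta> and \<open>L w\<close> fixed, \<psi> acts on the remaining plane as an
  element of O(2). No determinant is assumed; the second case describes \<psi> on all of four-space,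
  so that \<open>reflection_det\<close> applies to it.\<close>

lemma orthogonal_transformation_cases:
  assumes o: "orthogonal_transformation \<psi>" and fix_pole: "\<psi> \<zeta> = \<zeta>" and w: "norm w = 1" "\<psi> (L w) = L w"
  obtains (rotation) \<alpha> where "\<And>v. v \<bullet> w = 0 \<Longrightarrow> \<psi> (L v) = L (rot3 w \<alpha> v)"
  | (reflection) n where "norm n = 1" "n \<bullet> w = 0" "\<psi> = (\<lambda>x. x - (2 * (x \<bullet> L n)) *\<^sub>R L n)"
proof -
  have lin: "linear \<psi>" using o by (rule orthogonal_transformation_linear)
  note \<psi>_simps = linear_add[OF lin] linear_scale[OF lin]
  have inner: "\<psi> x \<bullet> \<psi> y = x \<bullet> y" for x y using o by (simp add: orthogonal_transformation_def)
  obtain e :: "real ^ 3" where e: "norm e = 1" "e \<bullet> w = 0" using orthogonal_unit_exists by (metis inner_commute)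
  define e2 where "e2 = cross3 w e"
  have e2: "norm e2 = 1" "e2 \<bullet> w = 0" "e \<bullet> e2 = 0"
    using norm_cross3_orthogonal[OF e(2)] e w by (simp_all add: e2_def dot_cross_self)
  have [simp]: "e \<bullet> e = 1" "e2 \<bullet> e2 = 1" "w \<bullet> w = 1" "e \<bullet> e2 = 0" "e2 \<bullet> e = 0" "e \<bullet> w = 0" "w \<bullet> e = 0" "e2 \<bullet> w = 0" "w \<bullet> e2 = 0"
    using e e2 w by (simp_all add: norm_eq_1 inner_commute)
  have ex: "\<exists>y. \<psi> (L x) = L y \<and> y \<bullet> w = 0 \<and> norm y = 1" if "norm x = 1" "x \<bullet> w = 0" for x
  proof -
    have "\<psi> (L x) \<bullet> \<zeta> = 0" using inner[of "L x" \<zeta>] by (simp add: fix_pole)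
    then obtain y where y: "\<psi> (L x) = L y" using L_surj by blast
    moreover have "y \<bullet> w = 0" using inner[of "L x" "L w"] that by (simp add: y w)
    moreover have "norm y = 1" using orthogonal_transformation_norm[OF o, of "L x"] that by (simp add: y)
    ultimately show ?thesis by blast
  qed
  obtain y1 where y1: "\<psi> (L e) = L y1" "y1 \<bullet> w = 0" "norm y1 = 1" using ex[OF e] by blast
  obtain y2 where y2: "\<psi> (L e2) = L y2" "y2 \<bullet> w = 0" "norm y2 = 1" using ex[OF e2(1,2)] by blast
  have y12: "y2 \<bullet> y1 = 0" using inner[of "L e2" "L e"] by (simp add: y1 y2)
  \<comment> \<open>The image of e fixes the image of e2 up to sign; this sign separates rotations
    from reflections.\<close>
  define s where "s = y2 \<bullet> cross3 w y1"
  have y2s: "y2 = s *\<^sub>R cross3 w y1"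
    using orthogonal_plane_eq[OF w(1) y1(3,2) y2(2)] y12 by (simp add: s_def)
  have "norm (cross3 w y1) = 1" using norm_cross3_orthogonal[OF y1(2)] y1 w by simp
  then have "\<bar>s\<bar> = 1" using y2(3) y2s by (metis norm_scaleR mult_1_right)
  then consider "s = 1" | "s = -1" by linarith
  note s = this
  have y1e: "y1 = (y1 \<bullet> e) *\<^sub>R e + (y1 \<bullet> e2) *\<^sub>R e2"
    unfolding e2_def by (rule orthogonal_plane_eq[OF w(1) e y1(2)])
  have "y1 \<bullet> y1 = (y1 \<bullet> e)\<^sup>2 + (y1 \<bullet> e2)\<^sup>2"
    by (subst (1 2) y1e) (simp add: inner_add_left inner_add_right power2_eq_square)
  then have "(y1 \<bullet> e)\<^sup>2 + (y1 \<bullet> e2)\<^sup>2 = 1" using y1(3) by (simp add: norm_eq_1)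
  then obtain \<alpha> where \<alpha>: "y1 \<bullet> e = cos \<alpha>" "y1 \<bullet> e2 = sin \<alpha>" using sincos_total_2pi by metis
  have y1\<alpha>: "y1 = cos \<alpha> *\<^sub>R e + sin \<alpha> *\<^sub>R e2" using y1e unfolding \<alpha> .
  have we2: "cross3 w e2 = - e" by (simp add: e2_def cross3_cross3_right)
  have wy1: "cross3 w y1 = cos \<alpha> *\<^sub>R e2 - sin \<alpha> *\<^sub>R e"
    by (simp add: y1\<alpha> cross_add_right cross_mult_right we2 flip: e2_def)
  have y2\<alpha>: "y2 = s *\<^sub>R (cos \<alpha> *\<^sub>R e2 - sin \<alpha> *\<^sub>R e)" using y2s unfolding wy1 .
  have \<psi>L: "\<psi> (L v) = L ((v \<bullet> e) *\<^sub>R y1 + (v \<bullet> e2) *\<^sub>R y2)" if "v \<bullet> w = 0" for v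
  proof -
    have "v = (v \<bullet> e) *\<^sub>R e + (v \<bullet> e2) *\<^sub>R e2"
      unfolding e2_def by (rule orthogonal_plane_eq[OF w(1) e that])
    then have "\<psi> (L v) = \<psi> (L ((v \<bullet> e) *\<^sub>R e + (v \<bullet> e2) *\<^sub>R e2))"
      by (rule arg_cong[where f = "\<lambda>x. \<psi> (L x)"])
    then show ?thesis by (simp add: L_simps \<psi>_simps y1 y2)
  qed
  from s show thesis
  proof cases
    case 1
    have "\<psi> (L v) = L (rot3 w \<alpha> v)" if v: "v \<bullet> w = 0" for v
    proof -
      have ve: "v = (v \<bullet> e) *\<^sub>R e + (v \<bullet> e2) *\<^sub>R e2"
        unfolding e2_def by (rule orthogonal_plane_eq[OF w(1) e v])
      have wv: "cross3 w v = (v \<bullet> e) *\<^sub>R e2 - (v \<bullet> e2) *\<^sub>R e"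
        by (subst ve) (simp add: cross_add_right cross_mult_right we2 flip: e2_def)
      have "(v \<bullet> e) *\<^sub>R y1 + (v \<bullet> e2) *\<^sub>R y2
         = cos \<alpha> *\<^sub>R ((v \<bullet> e) *\<^sub>R e + (v \<bullet> e2) *\<^sub>R e2) + sin \<alpha> *\<^sub>R ((v \<bullet> e) *\<^sub>R e2 - (v \<bullet> e2) *\<^sub>R e)"
        unfolding y2\<alpha> y1\<alpha> 1 by (simp add: algebra_simps)
      also have "\<dots> = rot3 w \<alpha> v" unfolding rot3_def wv by (simp flip: ve)
      finally show ?thesis using \<psi>L[OF v] by simp
    qed
    then show thesis by (rule rotation)
  next
    case 2
    \<comment> \<open>A plane reflection taking e to the direction at angle \<alpha> has its mirror
      line at half that angle; n below is normal to this line.\<close>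
    define \<beta> where "\<beta> = \<alpha> / 2"
    have ab: "cos \<alpha> = 1 - 2 * (sin \<beta>)\<^sup>2" "sin \<alpha> = 2 * sin \<beta> * cos \<beta>" "cos \<alpha> = 2 * (cos \<beta>)\<^sup>2 - 1"
      using cos_double_sin[of \<beta>] sin_double[of \<beta>] cos_double_cos[of \<beta>] by (simp_all add: \<beta>_def)
    define n where "n = sin \<beta> *\<^sub>R e - cos \<beta> *\<^sub>R e2"
    have "n \<bullet> n = (sin \<beta>)\<^sup>2 + (cos \<beta>)\<^sup>2"
      by (simp add: n_def inner_diff_left inner_diff_right power2_eq_square
          del: sin_cos_squared_add sin_cos_squared_add2 sin_cos_squared_add3)
    then have n: "norm n = 1" by (simp add: norm_eq_1)
    have nw: "n \<bullet> w = 0" by (simp add: n_def inner_diff_left)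
    have "\<psi> x = x - (2 * (x \<bullet> L n)) *\<^sub>R L n" for x
    proof -
      obtain t v' where x: "x = t *\<^sub>R \<zeta> + L v'" by (rule decompose)
      define v where "v = v' - (v' \<bullet> w) *\<^sub>R w"
      have v: "v \<bullet> w = 0" by (simp add: v_def inner_diff_left)
      have v': "v' = (v' \<bullet> w) *\<^sub>R w + v" by (simp add: v_def)
      have ve: "v = (v \<bullet> e) *\<^sub>R e + (v \<bullet> e2) *\<^sub>R e2"
        unfolding e2_def by (rule orthogonal_plane_eq[OF w(1) e v])
      have vn: "x \<bullet> L n = (v \<bullet> e) * sin \<beta> - (v \<bullet> e2) * cos \<beta>"
      proof -
        have "w \<bullet> n = 0" using nw by (simp add: inner_commute)
        then have "x \<bullet> L n = v \<bullet> n" by (simp add: x v_def inner_add_left inner_diff_left)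
        then show ?thesis by (simp add: n_def inner_diff_right)
      qed
      have "(v \<bullet> e) *\<^sub>R y1 + (v \<bullet> e2) *\<^sub>R y2
        = (v \<bullet> e) *\<^sub>R (cos \<alpha> *\<^sub>R e + sin \<alpha> *\<^sub>R e2) - (v \<bullet> e2) *\<^sub>R (cos \<alpha> *\<^sub>R e2 - sin \<alpha> *\<^sub>R e)"
        by (simp only: y2\<alpha> y1\<alpha> 2 scaleR_minus_left scaleR_minus_right scaleR_one add_uminus_conv_diff)
      also have "\<dots> = (v \<bullet> e) *\<^sub>R ((1 - 2 * (sin \<beta>)\<^sup>2) *\<^sub>R e + (2 * sin \<beta> * cos \<beta>) *\<^sub>R e2)
          - (v \<bullet> e2) *\<^sub>R ((2 * (cos \<beta>)\<^sup>2 - 1) *\<^sub>R e2 - (2 * sin \<beta> * cos \<beta>) *\<^sub>R e)"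
        unfolding ab(1)[symmetric] ab(3)[symmetric] ab(2) ..
      also have "\<dots> = ((v \<bullet> e) *\<^sub>R e + (v \<bullet> e2) *\<^sub>R e2) - (2 * (x \<bullet> L n)) *\<^sub>R n"
        unfolding vn unfolding n_def by (simp add: algebra_simps power2_eq_square)
      also have "\<dots> = v - (2 * (x \<bullet> L n)) *\<^sub>R n" unfolding ve[symmetric] ..
      finally have "\<psi> (L v) = L v - (2 * (x \<bullet> L n)) *\<^sub>R L n" using \<psi>L[OF v] by (simp add: L_simps)
      moreover have "\<psi> x = t *\<^sub>R \<zeta> + (v' \<bullet> w) *\<^sub>R L w + \<psi> (L v)"
      proof -
        have "\<psi> (L v') = \<psi> (L ((v' \<bullet> w) *\<^sub>R w + v))"
          using arg_cong[OF v', of "\<lambda>x. \<psi> (L x)"] .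
        then show ?thesis by (simp add: x L_simps \<psi>_simps fix_pole w)
      qed
      moreover have "x = t *\<^sub>R \<zeta> + (v' \<bullet> w) *\<^sub>R L w + L v"
        by (simp add: x v_def L_simps)
      ultimately show ?thesis by simp
    qed
    then have "\<psi> = (\<lambda>x. x - (2 * (x \<bullet> L n)) *\<^sub>R L n)" by (rule ext)
    then show thesis by (rule reflection[OF n nw])
  qed
qed

end

section \<open>Rotations fixing or reversing the pole, and half turns\<close>

context hyperplane_chart
begin

text \<open>Precompose with the reflection that negates \<open>L e2\<close>. The composite turns e
  by \<alpha> but sends e2 to the negative of its turned image, so it cannot be a rotation; being a
  reflection it has determinant -1.\<close>

lemma det_rotation:
  assumes o: "orthogonal_transformation \<psi>" and fix_pole: "\<psi> \<zeta> = \<zeta>" and w: "norm w = 1" "\<psi> (L w) = L w"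
    and rot: "\<And>v. v \<bullet> w = 0 \<Longrightarrow> \<psi> (L v) = L (rot3 w \<alpha> v)"
  shows "det (matrix \<psi>) = 1"
proof -
  obtain e :: "real ^ 3" where e: "norm e = 1" "e \<bullet> w = 0" using orthogonal_unit_exists by (metis inner_commute)
  define e2 where "e2 = cross3 w e"
  have e2: "norm e2 = 1" "e2 \<bullet> w = 0" "e \<bullet> e2 = 0" "w \<bullet> e2 = 0" "e2 \<bullet> e2 = 1"
    using norm_cross3_orthogonal[OF e(2)] e w by (simp_all add: e2_def dot_cross_self norm_eq_1)
  let ?r = "\<lambda>x. x - (2 * (x \<bullet> L e2)) *\<^sub>R L e2"
  have r: "orthogonal_transformation ?r" "det (matrix ?r) = -1"
    using e2(1) by (intro reflection_orthogonal reflection_det; simp)+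
  have o': "orthogonal_transformation (\<psi> \<circ> ?r)"
    using o r(1) by (rule orthogonal_transformation_compose)
  have fix': "(\<psi> \<circ> ?r) \<zeta> = \<zeta>" "(\<psi> \<circ> ?r) (L w) = L w" using w fix_pole e2 by simp_all
  have im: "(\<psi> \<circ> ?r) (L e) = L (rot3 w \<alpha> e)" "(\<psi> \<circ> ?r) (L e2) = L (- rot3 w \<alpha> e2)"
  proof -
    have "?r (L e2) = L (- e2)" using e2 by (simp add: L_simps scaleR_2)
    then show "(\<psi> \<circ> ?r) (L e2) = L (- rot3 w \<alpha> e2)" using rot[of "- e2"] e2(2) by (simp add: rot3_minus)
    show "(\<psi> \<circ> ?r) (L e) = L (rot3 w \<alpha> e)" using rot[OF e(2)] e2 by simp
  qed
  have "det (matrix (\<psi> \<circ> ?r)) = -1"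
  proof (rule orthogonal_transformation_cases[OF o' fix'(1) w(1) fix'(2)])
    fix \<beta> assume \<beta>: "\<And>v. v \<bullet> w = 0 \<Longrightarrow> (\<psi> \<circ> ?r) (L v) = L (rot3 w \<beta> v)"
    have "rot3 w \<beta> e = rot3 w \<alpha> e" using \<beta>[OF e(2)] im(1) by (simp add: L_eq_iff)
    then have "cross3 w (rot3 w \<beta> e) = cross3 w (rot3 w \<alpha> e)" by simp
    then have "rot3 w \<beta> e2 = rot3 w \<alpha> e2"
      by (simp add: rot3_def e2_def cross_add_right cross_mult_right)
    moreover have "rot3 w \<beta> e2 = - rot3 w \<alpha> e2" using \<beta>[OF e2(2)] im(2) by (simp add: L_eq_iff)
    ultimately have "rot3 w \<alpha> e2 + rot3 w \<alpha> e2 = 0" by (metis add.right_inverse)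
    then have "2 *\<^sub>R rot3 w \<alpha> e2 = 0" by (simp only: scaleR_2)
    then have "rot3 w \<alpha> e2 = 0" by simp
    then show ?thesis using norm_rot3[OF w(1) e2(2), of \<alpha>] e2(1) by simp
  next
    fix n assume "norm n = 1" and n: "\<psi> \<circ> ?r = (\<lambda>x. x - (2 * (x \<bullet> L n)) *\<^sub>R L n)"
    then show ?thesis unfolding n by (intro reflection_det) simp
  qed
  moreover have "det (matrix (\<psi> \<circ> ?r)) = det (matrix \<psi>) * det (matrix ?r)"
    using o r(1) by (simp only: matrix_compose orthogonal_transformation_linear det_mul)
  ultimately show ?thesis using r(2) by simp
qed

lemma SO3_fixing_pole:
  assumes \<phi>: "\<phi> \<in> SO3 (L w)" "\<phi> \<zeta> = \<zeta>" and w: "norm w = 1"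
  obtains \<alpha> where "\<And>v. v \<bullet> w = 0 \<Longrightarrow> \<phi> (L v) = L (rot3 w \<alpha> v)"
proof -
  have o: "orthogonal_transformation \<phi>" "det (matrix \<phi>) = 1" "\<phi> (L w) = L w"
    using \<phi>(1) by (auto simp: SO3_def)
  show thesis
  proof (rule orthogonal_transformation_cases[OF o(1) \<phi>(2) w o(3)])
    fix n assume "norm n = 1" and n: "\<phi> = (\<lambda>x. x - (2 * (x \<bullet> L n)) *\<^sub>R L n)"
    then have "det (matrix \<phi>) = -1" unfolding n by (intro reflection_det) simp
    then show thesis using o(2) by simp
  qed (rule that)
qed

text \<open>Precomposing with the reflection in the hyperplane orthogonal to \<zeta> restores the
  pole and makes the determinant -1. By \<open>det_rotation\<close> the composite is then a
  reflection, and it agrees with \<phi> on the range of \<open>L\<close>.\<close>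

lemma SO3_reversing_pole:
  assumes \<phi>: "\<phi> \<in> SO3 (L w)" "\<phi> \<zeta> = - \<zeta>" and w: "norm w = 1"
  obtains u where "norm u = 1" "u \<bullet> w = 0" "\<And>v. v \<bullet> w = 0 \<Longrightarrow> \<phi> (L v) = L ((2 * (v \<bullet> u)) *\<^sub>R u - v)"
proof -
  have o: "orthogonal_transformation \<phi>" "det (matrix \<phi>) = 1" "\<phi> (L w) = L w"
    using \<phi>(1) by (auto simp: SO3_def)
  let ?r = "\<lambda>x. x - (2 * (x \<bullet> \<zeta>)) *\<^sub>R \<zeta>"
  have r: "orthogonal_transformation ?r" "det (matrix ?r) = -1"
    using norm_pole by (intro reflection_orthogonal reflection_det; simp)+
  have o': "orthogonal_transformation (\<phi> \<circ> ?r)"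
    using o(1) r(1) by (rule orthogonal_transformation_compose)
  have "?r \<zeta> = (1 - 2) *\<^sub>R \<zeta>" by (simp only: scaleR_left_diff_distrib pole_pole mult_1_right scaleR_one)
  then have rz: "?r \<zeta> = - \<zeta>" by simp
  have fix': "(\<phi> \<circ> ?r) \<zeta> = \<zeta>" "(\<phi> \<circ> ?r) (L v) = \<phi> (L v)" for v
  proof -
    show "(\<phi> \<circ> ?r) \<zeta> = \<zeta>"
      unfolding comp_apply rz using \<phi>(2) linear_neg[OF orthogonal_transformation_linear[OF o(1)], of \<zeta>] by simp
    show "(\<phi> \<circ> ?r) (L v) = \<phi> (L v)" by simp
  qed
  have "det (matrix (\<phi> \<circ> ?r)) = det (matrix \<phi>) * det (matrix ?r)"
    using o(1) r(1) by (simp only: matrix_compose orthogonal_transformation_linear det_mul)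
  then have d: "det (matrix (\<phi> \<circ> ?r)) = -1" using o(2) r(2) by simp
  have fixw: "(\<phi> \<circ> ?r) (L w) = L w" unfolding fix'(2) by (rule o(3))
  show thesis
  proof (rule orthogonal_transformation_cases[OF o' fix'(1) w fixw])
    fix \<alpha> assume "\<And>v. v \<bullet> w = 0 \<Longrightarrow> (\<phi> \<circ> ?r) (L v) = L (rot3 w \<alpha> v)"
    then have "det (matrix (\<phi> \<circ> ?r)) = 1" by (rule det_rotation[OF o' fix'(1) w fixw])
    then show thesis using d by simp
  next
    fix n assume n: "norm n = 1" "n \<bullet> w = 0" and \<phi>r: "\<phi> \<circ> ?r = (\<lambda>x. x - (2 * (x \<bullet> L n)) *\<^sub>R L n)"
    \<comment> \<open>Within the plane orthogonal to w, negating n is the same as fixing the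
      perpendicular direction u.\<close>
    define u where "u = cross3 w n"
    show thesis
    proof (rule that[of u])
      show "norm u = 1" "u \<bullet> w = 0"
        using norm_cross3_orthogonal[OF n(2)] n w by (simp_all add: u_def dot_cross_self)
      fix v assume v: "v \<bullet> w = 0"
      have "\<phi> (L v) = L (v - (2 * (v \<bullet> n)) *\<^sub>R n)"
        using fun_cong[OF \<phi>r, of "L v"] fix'(2)[of v] by (simp add: L_simps)
      also have "v - (2 * (v \<bullet> n)) *\<^sub>R n = (2 * (v \<bullet> u)) *\<^sub>R u - v"
      proof -
        have "v = (v \<bullet> n) *\<^sub>R n + (v \<bullet> u) *\<^sub>R u"
          unfolding u_def by (rule orthogonal_plane_eq[OF w n v])
        then have "2 *\<^sub>R v = 2 *\<^sub>R ((v \<bullet> n) *\<^sub>R n + (v \<bullet> u) *\<^sub>R u)" by (rule arg_cong)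
        then show ?thesis by (simp add: algebra_simps scaleR_2)
      qed
      finally show "\<phi> (L v) = L ((2 * (v \<bullet> u)) *\<^sub>R u - v)" .
    qed
  qed
qed

text \<open>The half turn about \<open>L u\<close> reverses \<zeta>, so it exchanges the slices at
  heights t and -t while reflecting v in the line of u.\<close>

lemma pi_rotational_symmetry_tangent:
  assumes w: "norm w = 1" and u: "norm u = 1" "u \<bullet> w = 0"
    and sym: "\<And>t v. v \<bullet> w = 0 \<Longrightarrow> hom_extension f (- t *\<^sub>R \<zeta> + L ((2 * (v \<bullet> u)) *\<^sub>R u - v)) = hom_extension f (t *\<^sub>R \<zeta> + L v)"
  shows "pi_rotational_symmetry f (L w) (L u)"
proof -
  let ?\<phi> = "\<lambda>x. (2 * (x \<bullet> L u)) *\<^sub>R L u + (2 * (x \<bullet> L w)) *\<^sub>R L w - x"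
  have rot: "rotation_about (L w) (L u) pi ?\<phi>"
    using rotation_about_pi_iff[of "L w" "L u"] w u by (simp add: S2_def)
  then have o: "orthogonal_transformation ?\<phi>" by (simp add: rotation_about_def SO3_def)
  have "f (?\<phi> \<theta>) = f \<theta>" if \<theta>: "\<theta> \<in> S2 (L w)" for \<theta>
  proof -
    obtain t v where tv: "\<theta> = t *\<^sub>R \<zeta> + L v" by (rule decompose)
    have n: "norm \<theta> = 1" and v: "v \<bullet> w = 0" using \<theta> by (simp_all add: S2_def tv inner_add_left)
    have "?\<phi> \<theta> = - t *\<^sub>R \<zeta> + L ((2 * (v \<bullet> u)) *\<^sub>R u - v)"
      using v by (simp add: tv inner_add_left L_simps)
    then have "hom_extension f (?\<phi> \<theta>) = hom_extension f (- t *\<^sub>R \<zeta> + L ((2 * (v \<bullet> u)) *\<^sub>R u - v))" by (rule arg_cong)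
    also have "\<dots> = hom_extension f \<theta>" unfolding tv by (rule sym[OF v])
    finally have "hom_extension f (?\<phi> \<theta>) = hom_extension f \<theta>" .
    moreover have "norm (?\<phi> \<theta>) = 1" using orthogonal_transformation_norm[OF o, of \<theta>] n by simp
    ultimately show ?thesis using n by (simp only: hom_extension_unit)
  qed
  then show ?thesis using rot by (auto simp: pi_rotational_symmetry_def)
qed

text \<open>The half turn about the pole preserves each slice and is the antipodal map on its
  circle.\<close>

lemma pi_rotational_symmetry_pole:
  assumes w: "norm w = 1"
    and sym: "\<And>t v. v \<bullet> w = 0 \<Longrightarrow> hom_extension f (t *\<^sub>R \<zeta> + L (- v)) = hom_extension f (t *\<^sub>R \<zeta> + L v)"
  shows "pi_rotational_symmetry f (L w) \<zeta>"
proof -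
  let ?\<phi> = "\<lambda>x. (2 * (x \<bullet> \<zeta>)) *\<^sub>R \<zeta> + (2 * (x \<bullet> L w)) *\<^sub>R L w - x"
  have rot: "rotation_about (L w) \<zeta> pi ?\<phi>"
    using rotation_about_pi_iff[of "L w" \<zeta>] w norm_pole by (simp add: S2_def)
  then have o: "orthogonal_transformation ?\<phi>" by (simp add: rotation_about_def SO3_def)
  have "f (?\<phi> \<theta>) = f \<theta>" if \<theta>: "\<theta> \<in> S2 (L w)" for \<theta>
  proof -
    obtain t v where tv: "\<theta> = t *\<^sub>R \<zeta> + L v" by (rule decompose)
    have n: "norm \<theta> = 1" and v: "v \<bullet> w = 0" using \<theta> by (simp_all add: S2_def tv inner_add_left)
    have "?\<phi> \<theta> = (t + t) *\<^sub>R \<zeta> - (t *\<^sub>R \<zeta> + L v)"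
      using v by (simp add: tv inner_add_left)
    also have "\<dots> = t *\<^sub>R \<zeta> + L (- v)" by (simp only: scaleR_add_left L_simps) simp
    finally have "hom_extension f (?\<phi> \<theta>) = hom_extension f (t *\<^sub>R \<zeta> + L (- v))" by (rule arg_cong)
    also have "\<dots> = hom_extension f \<theta>" unfolding tv by (rule sym[OF v])
    finally have "hom_extension f (?\<phi> \<theta>) = hom_extension f \<theta>" .
    moreover have "norm (?\<phi> \<theta>) = 1" using orthogonal_transformation_norm[OF o, of \<theta>] n by simp
    ultimately show ?thesis using n by (simp only: hom_extension_unit)
  qed
  then show ?thesis using rot by (auto simp: pi_rotational_symmetry_def)
qed

end

text \<open>Turning the axis of a plane reflection by \<beta> amounts to first rotating by -2
  \<beta>. This combines a rotation and a reflection that match the same pair of functions into one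
  reflection symmetry.\<close>

lemma reflect_rot3:
  assumes w: "norm w = 1" and u: "norm u = 1" "u \<bullet> w = 0" and y: "y \<bullet> w = 0"
  shows "(2 * (y \<bullet> rot3 w \<beta> u)) *\<^sub>R rot3 w \<beta> u - y
       = (2 * (rot3 w (- 2 * \<beta>) y \<bullet> u)) *\<^sub>R u - rot3 w (- 2 * \<beta>) y"
proof -
  define u2 where "u2 = cross3 w u"
  define a where "a = y \<bullet> u"
  define b where "b = y \<bullet> u2"
  have yab: "y = a *\<^sub>R u + b *\<^sub>R u2" unfolding a_def b_def u2_def by (rule orthogonal_plane_eq[OF w u y])
  have "norm u2 = 1" using norm_cross3_orthogonal[OF u(2)] w u by (simp add: u2_def)
  then have [simp]: "u \<bullet> u = 1" "u2 \<bullet> u2 = 1" "u \<bullet> u2 = 0" "u2 \<bullet> u = 0"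
    using u by (simp_all add: norm_eq_1 u2_def dot_cross_self)
  have wu: "cross3 w u = u2" "cross3 w u2 = - u"
    using u w by (simp_all add: u2_def cross3_cross3_right norm_eq_1 inner_commute)
  have ru: "rot3 w \<beta> u = cos \<beta> *\<^sub>R u + sin \<beta> *\<^sub>R u2" by (simp add: rot3_def wu)
  have ry: "rot3 w (- 2 * \<beta>) y = (a * cos (2 * \<beta>) + b * sin (2 * \<beta>)) *\<^sub>R u + (b * cos (2 * \<beta>) - a * sin (2 * \<beta>)) *\<^sub>R u2"
    by (simp add: rot3_def yab cross_add_right cross_mult_right wu algebra_simps)
  have "y \<bullet> rot3 w \<beta> u = a * cos \<beta> + b * sin \<beta>"
    by (simp add: yab ru inner_add_left inner_add_right)
  then have "(2 * (y \<bullet> rot3 w \<beta> u)) *\<^sub>R rot3 w \<beta> u - y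
     = (a * (2 * (cos \<beta>)\<^sup>2 - 1) + b * (2 * sin \<beta> * cos \<beta>)) *\<^sub>R u + (a * (2 * sin \<beta> * cos \<beta>) - b * (1 - 2 * (sin \<beta>)\<^sup>2)) *\<^sub>R u2"
    unfolding ru by (simp only:) (simp add: yab algebra_simps power2_eq_square)
  also have "\<dots> = (a * cos (2 * \<beta>) + b * sin (2 * \<beta>)) *\<^sub>R u + (a * sin (2 * \<beta>) - b * cos (2 * \<beta>)) *\<^sub>R u2"
    unfolding cos_double_cos[symmetric] cos_double_sin[symmetric] sin_double[symmetric] ..
  also have "\<dots> = (2 * (rot3 w (- 2 * \<beta>) y \<bullet> u)) *\<^sub>R u - rot3 w (- 2 * \<beta>) y"
  proof -
    have "rot3 w (- 2 * \<beta>) y \<bullet> u = a * cos (2 * \<beta>) + b * sin (2 * \<beta>)"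
      unfolding ry by (simp add: inner_add_left)
    moreover have "A *\<^sub>R u + (- C) *\<^sub>R u2 = (2 * A) *\<^sub>R u - (A *\<^sub>R u + C *\<^sub>R u2)" for A C
      by (simp only: mult_2 scaleR_add_left scaleR_minus_left) simp
    ultimately show ?thesis unfolding ry by (metis minus_diff_eq)
  qed
  finally show ?thesis .
qed

text \<open>The set is the projection of a compact set of pairs of direction and angle; confining
  the angle to [0, 2 pi] loses nothing. The next lemma does the same with the axis u in the unit
  sphere.\<close>

lemma closed_rotation_directions:
  fixes F G :: "'i \<Rightarrow> real ^ 3 \<Rightarrow> real"
  assumes F: "\<And>i. continuous_on UNIV (F i)" and G: "\<And>i. continuous_on UNIV (G i)"
  shows "closed {w. norm w = 1 \<and> (\<exists>\<alpha>. \<forall>v. v \<bullet> w = 0 \<longrightarrow> (\<forall>i. F i (rot3 w \<alpha> v) = G i v))}" (is "closed ?A")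
proof -
  let ?K = "{p. norm (fst p) = 1 \<and> 0 \<le> snd p \<and> snd p \<le> 2 * pi \<and>
      (\<forall>x i. F i (rot3 (fst p) (snd p) (cross3 (fst p) x)) = G i (cross3 (fst p) x))}"
  have "closed ?K"
    by (intro closed_Collect_conj closed_Collect_all closed_Collect_eq closed_Collect_le
        continuous_on_compose2[OF F] continuous_on_compose2[OF G] continuous_rot3 continuous_on_cross
        continuous_intros) auto
  then have "compact ((sphere 0 1 \<times> {0..2 * pi}) \<inter> ?K)"
    by (intro compact_Int_closed compact_Times compact_sphere compact_Icc)
  moreover have "(sphere 0 1 \<times> {0..2 * pi}) \<inter> ?K = ?K" by auto
  ultimately have "compact ?K" by (simp only:)
  then have "compact (fst ` ?K)" by (intro compact_continuous_image continuous_on_fst continuous_on_id)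
  moreover have "fst ` ?K = ?A"
  proof (intro equalityI subsetI)
    fix w assume "w \<in> fst ` ?K"
    then show "w \<in> ?A" using ball_orthogonal_iff_cross3[of w] by force
  next
    fix w assume "w \<in> ?A"
    then obtain \<alpha> where w: "norm w = 1" and \<alpha>: "\<And>v i. v \<bullet> w = 0 \<Longrightarrow> F i (rot3 w \<alpha> v) = G i v" by blast
    obtain \<beta> where \<beta>: "0 \<le> \<beta>" "\<beta> < 2 * pi" "cos \<alpha> = cos \<beta>" "sin \<alpha> = sin \<beta>"
      using sincos_total_2pi[of "cos \<alpha>" "sin \<alpha>"] by auto
    have "rot3 w \<alpha> v = rot3 w \<beta> v" for v by (simp add: rot3_def \<beta>)
    then have "(w, \<beta>) \<in> ?K" using w \<alpha> \<beta>(1,2) by (auto simp: dot_cross_self)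
    from imageI[OF this, of fst] show "w \<in> fst ` ?K" by (simp only: fst_conv)
  qed
  ultimately have "compact ?A" by (simp only:)
  then show ?thesis by (rule compact_imp_closed)
qed

lemma closed_reflection_directions:
  fixes F G :: "'i \<Rightarrow> real ^ 3 \<Rightarrow> real"
  assumes F: "\<And>i. continuous_on UNIV (F i)" and G: "\<And>i. continuous_on UNIV (G i)"
  shows "closed {w. norm w = 1 \<and> (\<exists>u. norm u = 1 \<and> u \<bullet> w = 0 \<and>
     (\<forall>v. v \<bullet> w = 0 \<longrightarrow> (\<forall>i. F i ((2 * (v \<bullet> u)) *\<^sub>R u - v) = G i v)))}" (is "closed ?A")
proof -
  let ?K = "{p. norm (fst p) = 1 \<and> norm (snd p) = 1 \<and> snd p \<bullet> fst p = 0 \<and>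
      (\<forall>x i. F i ((2 * (cross3 (fst p) x \<bullet> snd p)) *\<^sub>R snd p - cross3 (fst p) x) = G i (cross3 (fst p) x))}"
  have "closed ?K"
    by (intro closed_Collect_conj closed_Collect_all closed_Collect_eq
        continuous_on_compose2[OF F] continuous_on_compose2[OF G] continuous_on_cross
        continuous_intros) auto
  then have "compact ((sphere 0 1 \<times> sphere 0 1) \<inter> ?K)"
    by (intro compact_Int_closed compact_Times compact_sphere)
  moreover have "(sphere 0 1 \<times> sphere 0 1) \<inter> ?K = ?K" by auto
  ultimately have "compact ?K" by (simp only:)
  then have "compact (fst ` ?K)" by (intro compact_continuous_image continuous_on_fst continuous_on_id)
  moreover have "fst ` ?K = ?A"
  proof (intro equalityI subsetI)
    fix w assume "w \<in> fst ` ?K"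
    then obtain u where u: "(w, u) \<in> ?K" by force
    then have "\<forall>v. v \<bullet> w = 0 \<longrightarrow> (\<forall>i. F i ((2 * (v \<bullet> u)) *\<^sub>R u - v) = G i v)"
      by (subst ball_orthogonal_iff_cross3) auto
    then show "w \<in> ?A" using u by auto
  next
    fix w assume "w \<in> ?A"
    then obtain u where "norm w = 1" "norm u = 1" "u \<bullet> w = 0"
      "\<And>v i. v \<bullet> w = 0 \<Longrightarrow> F i ((2 * (v \<bullet> u)) *\<^sub>R u - v) = G i v" by blast
    then have "(w, u) \<in> ?K" by (auto simp: dot_cross_self)
    from imageI[OF this, of fst] show "w \<in> fst ` ?K" by (simp only: fst_conv)
  qed
  ultimately have "compact ?A" by (simp only:)
  then show ?thesis by (rule compact_imp_closed)
qed

theorem proposition1: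
  fixes f g :: "real ^ 4 \<Rightarrow> real"
    and \<zeta> :: "real ^ 4"
    and \<phi> :: "real ^ 4 \<Rightarrow> real ^ 4 \<Rightarrow> real ^ 4"
  assumes "continuous_on S3 f" and "continuous_on S3 g"
    and "\<zeta> \<in> S3"
    and "\<forall>w\<in>S2 \<zeta>. \<phi> w \<in> SO3 w \<and> (\<forall>\<theta>\<in>S2 w. f (\<phi> w \<theta>) = g \<theta>)"
    and "(\<forall>w\<in>S2 \<zeta>. \<phi> w \<zeta> = \<zeta>) \<or>
         ((\<forall>w\<in>S2 \<zeta>. \<phi> w \<zeta> = \<zeta> \<or> \<phi> w \<zeta> = - \<zeta>) \<and>
          (\<forall>w\<in>S2 \<zeta>.
             \<not> pi_rotational_symmetry f w \<zeta> \<and> \<not> pi_rotational_symmetry g w \<zeta> \<and>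
             (\<forall>u\<in>S2 \<zeta> \<inter> S2 w.
                \<not> pi_rotational_symmetry f w u \<and> \<not> pi_rotational_symmetry g w u)))"
  shows "(\<forall>\<theta>\<in>S3. f \<theta> = g \<theta>) \<or>
         (\<exists>\<O>. orthogonal_transformation \<O> \<and> (\<forall>x\<in>S2 \<zeta>. \<O> x = - x) \<and> \<O> \<zeta> = \<zeta> \<and>
              (\<forall>\<theta>\<in>S3. f \<theta> = g (\<O> \<theta>)))"
proof -
  have nz: "norm \<zeta> = 1" using assms(3) by simp
  obtain L where "hyperplane_chart \<zeta> L" by (rule hyperplane_chart_exists[OF nz])
  then interpret hyperplane_chart \<zeta> L .
  have contL: "continuous_on UNIV L" using linear_L by (rule linear_continuous_on_compose[OF continuous_on_id])
  define F where "F t v = hom_extension f (t *\<^sub>R \<zeta> + L v)" for t v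
  define G where "G t v = hom_extension g (t *\<^sub>R \<zeta> + L v)" for t v
  have F: "continuous_on UNIV (F t)" for t
    unfolding F_def
    by (rule continuous_on_compose2[OF continuous_hom_extension[OF assms(1)]]) (intro continuous_intros contL, simp)
  have G: "continuous_on UNIV (G t)" for t
    unfolding G_def
    by (rule continuous_on_compose2[OF continuous_hom_extension[OF assms(2)]]) (intro continuous_intros contL, simp)
  \<comment> \<open>Both sets are described by F and G alone. They are therefore closed although
    \<phi> is not assumed to depend continuously on w.\<close>
  define A where "A = {w. norm w = 1 \<and> (\<exists>\<alpha>. \<forall>v. v \<bullet> w = 0 \<longrightarrow> (\<forall>t. F t (rot3 w \<alpha> v) = G t v))}"
  define B where "B = {w. norm w = 1 \<and> (\<exists>u. norm u = 1 \<and> u \<bullet> w = 0 \<and>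
     (\<forall>v. v \<bullet> w = 0 \<longrightarrow> (\<forall>t. F (- t) ((2 * (v \<bullet> u)) *\<^sub>R u - v) = G t v)))}"
  have \<phi>: "\<phi> (L w) \<in> SO3 (L w)" if "norm w = 1" for w
    using assms(4) L_in_S2_pole[OF that] by blast
  have lin: "\<phi> (L w) (t *\<^sub>R \<zeta> + L v) = t *\<^sub>R \<phi> (L w) \<zeta> + \<phi> (L w) (L v)" if "norm w = 1" for w t v
  proof -
    have "linear (\<phi> (L w))" using \<phi>[OF that] by (simp add: SO3_def orthogonal_transformation_linear)
    then show ?thesis by (simp add: linear_add linear_scale)
  qed
  have FG: "hom_extension f (\<phi> (L w) (t *\<^sub>R \<zeta> + L v)) = G t v" if "norm w = 1" "v \<bullet> w = 0" for w t v
    unfolding G_def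
  proof (rule hom_extension_orthogonal_transformation)
    show "orthogonal_transformation (\<phi> (L w))" using \<phi>[OF that(1)] by (simp add: SO3_def)
    show "f (\<phi> (L w) \<theta>) = g \<theta>" if "\<theta> \<in> S2 (L w)" for \<theta>
      using assms(4) L_in_S2_pole[OF \<open>norm w = 1\<close>] that by blast
    show "(t *\<^sub>R \<zeta> + L v) \<bullet> L w = 0" using that by (simp add: inner_add_left)
  qed
  have fixing: "w \<in> A" if w: "norm w = 1" and pole: "\<phi> (L w) \<zeta> = \<zeta>" for w
  proof -
    obtain \<alpha> where \<alpha>: "\<And>v. v \<bullet> w = 0 \<Longrightarrow> \<phi> (L w) (L v) = L (rot3 w \<alpha> v)"
      using SO3_fixing_pole[OF \<phi>[OF w] pole w] by blast
    have "F t (rot3 w \<alpha> v) = G t v" if "v \<bullet> w = 0" for t v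
      using FG[OF w that, of t] unfolding lin[OF w] pole \<alpha>[OF that] F_def .
    then show ?thesis using w by (auto simp: A_def)
  qed
  have reversing: "w \<in> B" if w: "norm w = 1" and rev: "\<phi> (L w) \<zeta> = - \<zeta>" for w
  proof -
    obtain u where u: "norm u = 1" "u \<bullet> w = 0"
      and \<phi>u: "\<And>v. v \<bullet> w = 0 \<Longrightarrow> \<phi> (L w) (L v) = L ((2 * (v \<bullet> u)) *\<^sub>R u - v)"
      using SO3_reversing_pole[OF \<phi>[OF w] rev w] by blast
    have "F (- t) ((2 * (v \<bullet> u)) *\<^sub>R u - v) = G t v" if "v \<bullet> w = 0" for t v
      using FG[OF w that, of t] unfolding lin[OF w] rev \<phi>u[OF that] F_def scaleR_minus_left scaleR_minus_right .
    then show ?thesis using w u by (auto simp: B_def)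
  qed
  have "sphere 0 1 \<subseteq> A"
    using assms(5)
  proof
    assume "\<forall>w\<in>S2 \<zeta>. \<phi> w \<zeta> = \<zeta>"
    then show ?thesis using fixing L_in_S2_pole by auto
  next
    assume asm: "(\<forall>w\<in>S2 \<zeta>. \<phi> w \<zeta> = \<zeta> \<or> \<phi> w \<zeta> = - \<zeta>) \<and>
          (\<forall>w\<in>S2 \<zeta>.
             \<not> pi_rotational_symmetry f w \<zeta> \<and> \<not> pi_rotational_symmetry g w \<zeta> \<and>
             (\<forall>u\<in>S2 \<zeta> \<inter> S2 w.
                \<not> pi_rotational_symmetry f w u \<and> \<not> pi_rotational_symmetry g w u))"
    have cover: "sphere 0 1 \<subseteq> A \<union> B"
    proof
      fix w :: "real ^ 3" assume "w \<in> sphere 0 1"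
      then have w: "norm w = 1" by simp
      then have "\<phi> (L w) \<zeta> = \<zeta> \<or> \<phi> (L w) \<zeta> = - \<zeta>" using asm L_in_S2_pole by blast
      then show "w \<in> A \<union> B" using fixing[OF w] reversing[OF w] by blast
    qed
    have "closed A" unfolding A_def by (rule closed_rotation_directions[OF F G])
    moreover have "closed B" unfolding B_def by (rule closed_reflection_directions[OF F G])
    moreover have "A \<inter> B = {}"
    proof (rule ccontr)
      assume "A \<inter> B \<noteq> {}"
      then obtain w where "w \<in> A" "w \<in> B" by blast
      from \<open>w \<in> A\<close> obtain \<alpha> where w: "norm w = 1"
        and \<alpha>: "\<And>v t. v \<bullet> w = 0 \<Longrightarrow> F t (rot3 w \<alpha> v) = G t v"
        unfolding A_def by blast
      from \<open>w \<in> B\<close> obtain u where u: "norm u = 1" "u \<bullet> w = 0"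
        and refl: "\<And>v t. v \<bullet> w = 0 \<Longrightarrow> F (- t) ((2 * (v \<bullet> u)) *\<^sub>R u - v) = G t v"
        unfolding B_def by blast
      \<comment> \<open>Reflecting in u after undoing the rotation by \<alpha> is the reflection
        whose axis is u turned by half of \<alpha>. It carries F at height t to F at height -t, a
        symmetry excluded by condition (b).\<close>
      define u' where "u' = rot3 w (\<alpha> / 2) u"
      have u': "norm u' = 1" "u' \<bullet> w = 0"
        using norm_rot3[OF w u(2)] inner_rot3_axis[OF u(2)] u(1) by (simp_all add: u'_def)
      have "F (- t) ((2 * (y \<bullet> u')) *\<^sub>R u' - y) = F t y" if y: "y \<bullet> w = 0" for t y
      proof -
        let ?v = "rot3 w (- \<alpha>) y"
        have v: "?v \<bullet> w = 0" using inner_rot3_axis[OF y] .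
        have "F (- t) ((2 * (y \<bullet> u')) *\<^sub>R u' - y) = F (- t) ((2 * (?v \<bullet> u)) *\<^sub>R u - ?v)"
          using reflect_rot3[OF w u y, of "\<alpha> / 2"] by (simp add: u'_def)
        also have "\<dots> = F t (rot3 w \<alpha> ?v)" using \<alpha>[OF v] refl[OF v] by simp
        also have "rot3 w \<alpha> ?v = y" unfolding rot3_rot3[OF w y] by (simp add: rot3_def)
        finally show ?thesis .
      qed
      then have "pi_rotational_symmetry f (L w) (L u')"
        using pi_rotational_symmetry_tangent[OF w u'] by (simp add: F_def)
      moreover have "L u' \<in> S2 \<zeta> \<inter> S2 (L w)" using u' by (simp add: S2_def)
      ultimately show False using asm L_in_S2_pole[OF w] by blast
    qed
    moreover have "connected (sphere (0 :: real ^ 3) 1)" by (rule connected_sphere) simp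
    ultimately have "A \<inter> sphere 0 1 = {} \<or> B \<inter> sphere 0 1 = {}"
      using cover unfolding connected_closed by (metis Int_empty_left)
    then show ?thesis
    proof
      assume "B \<inter> sphere 0 1 = {}"
      then show ?thesis using cover by blast
    next
      assume "A \<inter> sphere 0 1 = {}"
      then have "sphere 0 1 \<subseteq> B" using cover by blast
      \<comment> \<open>The evenness obtained below concerns unit vectors only, so the radius r
        joins the index and one w serves all heights and radii. The sign of t records that the
        reflections exchange the heights t and -t.\<close>
      define F' where "F' = (\<lambda>(t, r) v. F (- t) (r *\<^sub>R v))"
      define G' where "G' = (\<lambda>(t, r) v. G t (r *\<^sub>R v))"
      have "\<exists>w. norm w = 1 \<and> (\<forall>v i. norm v = 1 \<longrightarrow> v \<bullet> w = 0 \<longrightarrow> F' i (- v) = F' i v)"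
      proof (rule great_circle_reflections)
        show "continuous_on UNIV (F' i)" "continuous_on UNIV (G' i)" for i
          by (auto simp: F'_def G'_def case_prod_unfold
              intro!: continuous_on_compose2[OF F] continuous_on_compose2[OF G] continuous_intros)
        fix w :: "real ^ 3" assume "norm w = 1"
        then have "w \<in> B" using \<open>sphere 0 1 \<subseteq> B\<close> by auto
        then obtain u where u: "norm u = 1" "u \<bullet> w = 0"
          and refl: "\<And>v t. v \<bullet> w = 0 \<Longrightarrow> F (- t) ((2 * (v \<bullet> u)) *\<^sub>R u - v) = G t v"
          unfolding B_def by blast
        have "F' i ((2 * (v \<bullet> u)) *\<^sub>R u - v) = G' i v" if v: "v \<bullet> w = 0" for v i
          using refl[of "snd i *\<^sub>R v" "fst i"] v
          by (simp add: F'_def G'_def case_prod_unfold scaleR_diff_right mult_ac)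
        then show "\<exists>u. norm u = 1 \<and> u \<bullet> w = 0 \<and> (\<forall>v. v \<bullet> w = 0 \<longrightarrow> (\<forall>i. F' i ((2 * (v \<bullet> u)) *\<^sub>R u - v) = G' i v))"
          using u by blast
      qed
      then obtain w where w: "norm w = 1"
        and even: "\<And>v i. norm v = 1 \<Longrightarrow> v \<bullet> w = 0 \<Longrightarrow> F' i (- v) = F' i v" by blast
      have "F t (- v) = F t v" if "v \<bullet> w = 0" for t v
      proof (cases "v = 0")
        case False
        have "norm (sgn v) = 1" "sgn v \<bullet> w = 0" using False that by (simp_all add: norm_sgn sgn_div_norm)
        from even[OF this, of "(- t, norm v)"] show ?thesis using False by (simp add: F'_def sgn_div_norm)
      qed simp
      then have "pi_rotational_symmetry f (L w) \<zeta>"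
        using pi_rotational_symmetry_pole[OF w] by (simp add: F_def)
      then show ?thesis using asm L_in_S2_pole[OF w] by blast
    qed
  qed
  then have "\<exists>\<alpha>. \<forall>v. v \<bullet> w = 0 \<longrightarrow> (\<forall>t. F t (rot3 w \<alpha> v) = G t v)" if "norm w = 1" for w
    using that by (auto simp: A_def)
  from great_circle_rotations[OF F G this]
  show ?thesis
  proof
    assume eq: "\<forall>t v. F t v = G t v"
    have "f \<theta> = g \<theta>" if "norm \<theta> = 1" for \<theta>
    proof -
      obtain t v where "\<theta> = t *\<^sub>R \<zeta> + L v" by (rule decompose)
      then have "hom_extension f \<theta> = hom_extension g \<theta>" using eq by (simp add: F_def G_def)
      then show ?thesis using that by (simp only: hom_extension_unit)
    qed
    then show ?thesis by auto
  next
    assume eq: "\<forall>t v. F t v = G t (- v)"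
    \<comment> \<open>The negative of the reflection in the hyperplane orthogonal to \<zeta>: it
      negates that hyperplane and fixes the pole.\<close>
    define \<O> where "\<O> x = - (x - (2 * (x \<bullet> \<zeta>)) *\<^sub>R \<zeta>)" for x
    have o: "orthogonal_transformation \<O>"
      unfolding \<O>_def using reflection_orthogonal[OF nz] by (simp only: orthogonal_transformation_neg)
    have \<O>\<zeta>: "\<O> \<zeta> = \<zeta>"
    proof -
      have "\<O> \<zeta> = - ((1 - 2) *\<^sub>R \<zeta>)"
        unfolding \<O>_def by (simp only: scaleR_left_diff_distrib pole_pole mult_1_right scaleR_one)
      then show ?thesis by simp
    qed
    have "f \<theta> = g (\<O> \<theta>)" if "norm \<theta> = 1" for \<theta>
    proof -
      obtain t v where tv: "\<theta> = t *\<^sub>R \<zeta> + L v" by (rule decompose)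
      have "\<O> \<theta> = t *\<^sub>R \<O> \<zeta> + \<O> (L v)"
        using orthogonal_transformation_linear[OF o] by (simp add: tv linear_add linear_scale)
      also have "\<dots> = t *\<^sub>R \<zeta> + L (- v)" unfolding \<O>\<zeta> by (simp add: \<O>_def L_simps)
      finally have "hom_extension f \<theta> = hom_extension g (\<O> \<theta>)" using eq tv by (simp add: F_def G_def)
      moreover have "norm (\<O> \<theta>) = 1" using orthogonal_transformation_norm[OF o, of \<theta>] that by simp
      ultimately show ?thesis using that by (simp only: hom_extension_unit)
    qed
    moreover have "\<O> x = - x" if "x \<in> S2 \<zeta>" for x using that by (simp add: S2_def \<O>_def)
    ultimately show ?thesis using o \<O>\<zeta> by (intro disjI2 exI[of _ \<O>]) auto
  qed
qed

end
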